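(* Let $k\ge1$, $p_1,\dots,p_k\in\mathbb{N}_0$, $m_1,\dots,m_{k+1}\in\mathbb{N}$, and $|p|_j=p_1+\cdots+p_j$ ($|p|_0=0$). Then \begin{align*} &(-1)^{m_1}\zeta\left(\overline{1},\{1\}_{m_1-1},\overline{p_1+1},\{1\}_{m_2-1},p_2+1,\ldots,\{1\}_{m_k-1},p_k+1,\{1\}_{m_{k+1}-1}\right)\\ &=\sum_{i=1}^k(-1)^{|p|_{i-1}}\sum_{j=1}^{p_i}(-1)^{j-1}\zeta\left(E_i,\{1\}_{p_i-j}\right)\sum_{n=1}^\infty\frac{\zeta_{n-1}(\{1\}_{m_1-1})\,\zeta^\star_n(F_i,\{1\}_{j-1})}{n2^n}\\ &\quad+(-1)^{|p|_k}\sum_{n=1}^\infty\frac{\zeta_{n-1}(\{1\}_{m_1-1})\,\zeta^\star_n(F_{k+1})}{n2^n}, \end{align*} where $E_i=\{m_{k+1}+1\}\Box\{1\}_{p_k-1}\Box\{m_k+1\}\Box\cdots\Box\{m_{i+2}+1\}\Box\{1\}_{p_{i+1}-1}\Box\{m_{i+1}+1\}$ ($E_k=(m_{k+1}+1)$), and $F_i=\{1\}_{p_1-1}\Box\{m_2+1\}\Box\{1\}_{p_2-1}\Box\cdots\Box\{1\}_{p_{i-1}-1}\Box\{m_i+1\}$ ($F_1=\emptyset$), with the conventions described in the context.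
   Context: Alternating MZVs: for nonzero integers $s_j$ (overlined $\overline{s}$ means $-s$), $\zeta(s_1,\dots,s_k)=\sum_{n_1>\cdots>n_k\ge1}\prod_j\mathrm{sgn}(s_j)^{n_j}n_j^{-|s_j|}$. Multiple harmonic sums: $\zeta_n(s_1,\dots,s_r)=\sum_{n\ge n_1>\cdots>n_r\ge1}\prod n_j^{-s_j}$, $\zeta^\star_n(s_1,\dots,s_r)=\sum_{n\ge n_1\ge\cdots\ge n_r\ge1}\prod n_j^{-s_j}$, both $=1$ for the empty index. $\{1\}_d$ is $d$ entries $1$. Box convention: in a string $u\,\Box\,\{1\}_{p-1}\,\Box\,v$ one writes $u,\{1\}_{p-1},v$ if $p\ge1$, and if $p=0$ the two neighbouring entries $u,v$ are replaced by the single entry $u+v-1$ (applied repeatedly for consecutive zero $p$'s). Leading convention for $F_i$: write the string $1\,\Box\,\{1\}_{p_1-1}\,\Box\,\{m_2+1\}\Box\cdots\Box\{m_i+1\}$ (for $i=1$ just $(1)$), evaluated by the Box convention, as $(x_0,x_1,\dots,x_q)$; then $\zeta^\star_n(F_i,\{1\}_{j-1})$ means $n^{1-x_0}\zeta^\star_n(x_1,\dots,x_q,\{1\}_{j-1})$. (So if $p_1\ge1$ this is the ordinary $\zeta^\star_n(\{1\}_{p_1-1},m_2+1,\dots)$; if $p_1=\cdots=p_{r-1}=0$, $p_r\ge1$, it equals $n^{-(m_2+\cdots+m_r)}\zeta^\star_n(\{1\}_{p_r-1},\{m_{r+1}+1\}\Box\cdots\Box\{m_i+1\},\{1\}_{j-1})$.)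 *)

theory Defs
  imports "HOL-Analysis.Analysis"
begin

definition decr_tuples :: "nat \<Rightarrow> nat \<Rightarrow> nat list set" where
  "decr_tuples N d = {ns. length ns = d \<and> set ns \<subseteq> {1..N} \<and> sorted_wrt (>) ns}"

definition weak_decr_tuples :: "nat \<Rightarrow> nat \<Rightarrow> nat list set" where
  "weak_decr_tuples N d = {ns. length ns = d \<and> set ns \<subseteq> {1..N} \<and> sorted_wrt (\<ge>) ns}"

definition mhs :: "nat \<Rightarrow> nat list \<Rightarrow> real" where
  "mhs N ss = (\<Sum>ns\<in>decr_tuples N (length ss). \<Prod>j<length ss. 1 / real (ns ! j) ^ (ss ! j))"

definition mhs_star :: "nat \<Rightarrow> nat list \<Rightarrow> real" where
  "mhs_star N ss = (\<Sum>ns\<in>weak_decr_tuples N (length ss). \<Prod>j<length ss. 1 / real (ns ! j) ^ (ss ! j))"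

definition alt_mhs :: "nat \<Rightarrow> int list \<Rightarrow> real" where
  "alt_mhs N ss = (\<Sum>ns\<in>decr_tuples N (length ss).
     \<Prod>j<length ss. of_int (sgn (ss ! j)) ^ (ns ! j) / real (ns ! j) ^ nat \<bar>ss ! j\<bar>)"

text \<open>The series is only conditionally convergent when the first entry is \<open>-1\<close>; as usual its value is
  then the limit of the truncations \<open>N \<ge> n\<^sub>1 > \<dots> > n\<^sub>k \<ge> 1\<close>. An overlined entry is a negative integer.\<close>

definition alt_mzv :: "int list \<Rightarrow> real" where
  "alt_mzv ss = lim (\<lambda>N. alt_mhs N ss)"

text \<open>\<open>box_string u [(p\<^sub>1, v\<^sub>1), \<dots>, (p\<^sub>r, v\<^sub>r)]\<close> evaluates
  \<open>u \<box> {1}\<^bsub>p\<^sub>1 - 1\<^esub> \<box> v\<^sub>1 \<box> \<dots> \<box> {1}\<^bsub>p\<^sub>r - 1\<^esub> \<box> v\<^sub>r\<close>; all entries occurring below are positive,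
  so the subtractions do not truncate.\<close>

fun box_string :: "nat \<Rightarrow> (nat \<times> nat) list \<Rightarrow> nat list" where
  "box_string u [] = [u]"
| "box_string u ((p, v) # ps) =
     (if p = 0 then box_string (u + v - 1) ps else u # replicate (p - 1) 1 @ box_string v ps)"

definition E_index :: "nat \<Rightarrow> (nat \<Rightarrow> nat) \<Rightarrow> (nat \<Rightarrow> nat) \<Rightarrow> nat \<Rightarrow> nat list" where
  "E_index k p m i = box_string (m (k + 1) + 1) (map (\<lambda>l. (p l, m l + 1)) (rev [i + 1..<k + 1]))"

text \<open>The string \<open>(x\<^sub>0, \<dots>, x\<^sub>q)\<close> obtained from \<open>F\<^sub>i\<close> by prefixing an entry \<open>1\<close>; the prefix \<open>x\<^sub>0\<close> is
  turned into the factor \<open>n\<^bsup>1 - x\<^sub>0\<^esup>\<close> by \<open>lead_star\<close>.\<close>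

definition F_index :: "(nat \<Rightarrow> nat) \<Rightarrow> (nat \<Rightarrow> nat) \<Rightarrow> nat \<Rightarrow> nat list" where
  "F_index p m i = box_string 1 (map (\<lambda>l. (p l, m (l + 1) + 1)) [1..<i])"

definition lead_star :: "nat \<Rightarrow> nat list \<Rightarrow> real" where
  "lead_star n xs = real n powi (1 - int (hd xs)) * mhs_star n (tl xs)"

definition lhs_index :: "nat \<Rightarrow> (nat \<Rightarrow> nat) \<Rightarrow> (nat \<Rightarrow> nat) \<Rightarrow> int list" where
  "lhs_index k p m =
     - 1 # replicate (m 1 - 1) 1 @ - int (p 1 + 1) # replicate (m 2 - 1) 1 @
     concat (map (\<lambda>l. int (p l + 1) # replicate (m (l + 1) - 1) 1) [2..<k + 1])"

end

theory Submission
  imports Defs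
begin

text \<open>Up to the sign \<open>(-1)\<^bsup>m\<^sub>1\<^esup>\<close>, the alternating zeta value is the iterated integral over \<open>[0, 1]\<close> of the forms
  \<open>(dt/(1+t))\<^bsup>m\<^sub>1\<^esup> (dt/t)\<^bsup>p\<^sub>1\<^esup> (dt/(1-t))\<^bsup>m\<^sub>2\<^esup> \<dots> (dt/t)\<^bsup>p\<^sub>k\<^esup> (dt/(1-t))\<^bsup>m\<^sub>k\<^sub>+\<^sub>1\<^esup>\<close>, outermost form first.
  The substitution \<open>t \<mapsto> 1 - t\<close> reverses the word and turns \<open>dt/(1+t)\<close> into \<open>dt/(2-t)\<close>; the innermost
  block becomes the series \<open>\<Sum>\<^sub>n \<zeta>\<^sub>n\<^sub>-\<^sub>1({1}\<^bsub>m\<^sub>1-1\<^esub>) t\<^sup>n / (n 2\<^sup>n)\<close>. The remaining forms applied to \<open>t\<^sup>n\<close> give a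
  sum over chains \<open>N\<^sub>1 > \<dots> > N\<^sub>d > n\<close>, and replacing each condition \<open>N\<^sub>i > N\<^sub>i\<^sub>+\<^sub>1\<close> in turn, from the inside,
  by the complement of \<open>N\<^sub>i \<le> N\<^sub>i\<^sub>+\<^sub>1\<close> splits it into products of zeta values and star sums.

  No integrals are needed: iterated integrals are power series \<open>L\<^sub>w\<close>, and the substitution follows since the
  path composition sum of products \<open>L\<^sub>v(t) L\<^sub>u(1-t)\<close> over all ways to cut the word has derivative \<open>0\<close>, with
  Abel's limit theorem at the end points.\<close>

section \<open>Abel summation\<close>

lemma summable_bounded_powser:
  fixes a :: "nat \<Rightarrow> real"
  assumes "\<And>n. \<bar>a n\<bar> \<le> K" and "\<bar>t\<bar> < 1"
  shows "summable (\<lambda>n. a n * t ^ n)"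
proof (rule summable_comparison_test)
  have "norm (a n * t ^ n) \<le> K * \<bar>t\<bar> ^ n" for n
    using assms(1)[of n] by (simp add: abs_mult power_abs mult_right_mono)
  then show "\<exists>N. \<forall>n\<ge>N. norm (a n * t ^ n) \<le> K * \<bar>t\<bar> ^ n"
    by blast
  show "summable (\<lambda>n. K * \<bar>t\<bar> ^ n)"
    using assms(2) by (intro summable_mult summable_geometric) auto
qed

lemma eventually_in_unit_interval: "eventually (\<lambda>t::real. 0 < t \<and> t < 1) (at_left 1)"
  using eventually_at_leftI[of 0 1 "\<lambda>t::real. 0 < t \<and> t < 1"] by auto

text \<open>Terms from \<open>N\<close> on contribute at most e/2 times a geometric series, whose
  sum 1/(1 - t) the prefactor cancels; the others stay bounded by \<open>B\<close> and are killed by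
  1 - t. Besides Abel's theorem, this controls the end point terms of the path composition.\<close>

lemma null_seq_powser_at_left_1:
  fixes a :: "nat \<Rightarrow> real"
  assumes "a \<longlonglongrightarrow> 0"
  shows "((\<lambda>t. (1 - t) * (\<Sum>n. a n * t ^ n)) \<longlongrightarrow> 0) (at_left 1)"
proof (rule tendstoI)
  fix e :: real assume e: "e > 0"
  have "Bseq a"
    using assms convergent_def convergent_imp_Bseq by blast
  then obtain K where K: "\<And>n. \<bar>a n\<bar> \<le> K"
    by (auto simp: Bseq_def)
  obtain N where N: "\<And>n. n \<ge> N \<Longrightarrow> \<bar>a n\<bar> \<le> e / 2"
    using LIMSEQ_D[OF assms, of "e / 2"] e by (auto intro: less_imp_le)
  define B where "B = (\<Sum>n<N. \<bar>a n\<bar>)"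
  have B: "B \<ge> 0" unfolding B_def by (intro sum_nonneg) auto
  have bound: "\<bar>(1 - t) * (\<Sum>n. a n * t ^ n)\<bar> \<le> (1 - t) * B + e / 2" if t: "0 < t" "t < 1" for t
  proof -
    have sm: "summable (\<lambda>n. a n * t ^ n)"
      using summable_bounded_powser[of a K t] K t by auto
    have sm': "summable (\<lambda>n. (e / 2) * t ^ n)"
      using t by (intro summable_mult summable_geometric) auto
    have sm'': "summable (\<lambda>n. if n < N then \<bar>a n\<bar> else 0)"
      by (rule summable_finite[of "{..<N}"]) auto
    have le: "\<bar>a n * t ^ n\<bar> \<le> (if n < N then \<bar>a n\<bar> else 0) + (e / 2) * t ^ n" for n
    proof (cases "n < N")
      case True
      have "\<bar>a n\<bar> * t ^ n \<le> \<bar>a n\<bar> * 1"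
        using t by (intro mult_left_mono) (auto simp: power_le_one)
      then show ?thesis
        using True t e by (simp add: abs_mult add_increasing2)
    next
      case False
      then show ?thesis
        using N[of n] t by (auto simp: abs_mult intro!: mult_right_mono)
    qed
    have smabs: "summable (\<lambda>n. \<bar>a n * t ^ n\<bar>)"
      by (rule summable_comparison_test'[where N = 0, OF summable_add[OF sm'' sm']]) (use le in auto)
    have "\<bar>\<Sum>n. a n * t ^ n\<bar> \<le> (\<Sum>n. \<bar>a n * t ^ n\<bar>)"
      using summable_rabs[OF smabs] .
    also have "\<dots> \<le> (\<Sum>n. (if n < N then \<bar>a n\<bar> else 0) + (e / 2) * t ^ n)"
      by (intro suminf_le le smabs summable_add sm' sm'')
    also have "\<dots> = (\<Sum>n. if n < N then \<bar>a n\<bar> else 0) + (\<Sum>n. (e / 2) * t ^ n)"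
      by (rule suminf_add[symmetric, OF sm'' sm'])
    also have "(\<Sum>n. if n < N then \<bar>a n\<bar> else 0) = B"
      unfolding B_def by (subst suminf_finite[of "{..<N}"]) auto
    also have "(\<Sum>n. (e / 2) * t ^ n) = e / 2 * (1 / (1 - t))"
      using t by (subst suminf_mult) (auto simp: suminf_geometric)
    finally have *: "\<bar>\<Sum>n. a n * t ^ n\<bar> \<le> B + e / 2 * (1 / (1 - t))" .
    have "\<bar>(1 - t) * (\<Sum>n. a n * t ^ n)\<bar> = (1 - t) * \<bar>\<Sum>n. a n * t ^ n\<bar>"
      using t by (simp add: abs_mult)
    also have "\<dots> \<le> (1 - t) * (B + e / 2 * (1 / (1 - t)))"
      using t * by (intro mult_left_mono) auto
    also have "\<dots> = (1 - t) * B + e / 2"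
      using t by (simp add: field_simps)
    finally show ?thesis .
  qed
  have lim: "((\<lambda>t. (1 - t) * B + e / 2) \<longlongrightarrow> (1 - 1) * B + e / 2) (at_left 1)"
    by (intro tendsto_intros)
  have "eventually (\<lambda>t. (1 - t) * B + e / 2 < e) (at_left 1)"
    using order_tendstoD(2)[OF lim, of e] e by simp
  moreover have "eventually (\<lambda>t::real. 0 < t \<and> t < 1) (at_left 1)"
    by (rule eventually_in_unit_interval)
  ultimately show "eventually (\<lambda>t. dist ((1 - t) * (\<Sum>n. a n * t ^ n)) 0 < e) (at_left 1)"
    by eventually_elim (use bound in force)
qed

text \<open>Summation by parts: the series is S plus 1 - t times the power series of the errors
  \<open>s n - S\<close>, which form a null sequence.\<close>

lemma Abel_limit_at_left_1:
  fixes c :: "nat \<Rightarrow> real"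
  assumes "c sums S"
  shows "((\<lambda>t. \<Sum>n. c n * t ^ n) \<longlongrightarrow> S) (at_left 1)"
proof -
  define s where "s n = (\<Sum>i<Suc n. c i)" for n
  have s: "s \<longlonglongrightarrow> S"
    using assms unfolding s_def sums_def by (rule LIMSEQ_Suc)
  have null: "(\<lambda>n. s n - S) \<longlonglongrightarrow> 0"
    using s by (simp add: LIM_zero)
  have eq: "(\<Sum>n. c n * t ^ n) = S + (1 - t) * (\<Sum>n. (s n - S) * t ^ n)" if t: "0 < t" "t < 1" for t
  proof -
    have "Bseq c"
      using assms by (auto simp: sums_iff intro: summable_imp_Bseq)
    then obtain K where K: "\<And>n. \<bar>c n\<bar> \<le> K"
      by (auto simp: Bseq_def)
    have "Bseq (\<lambda>n. s n - S)"
      using null convergent_def convergent_imp_Bseq by blast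
    then obtain L where L: "\<And>n. \<bar>s n - S\<bar> \<le> L"
      by (auto simp: Bseq_def)
    have smc: "summable (\<lambda>n. c n * t ^ n)"
      using summable_bounded_powser[of c K t] K t by auto
    have sms: "summable (\<lambda>n. (s n - S) * t ^ n)"
      using summable_bounded_powser[of "\<lambda>n. s n - S" L t] L t by auto
    have smss: "summable (\<lambda>n. (s (Suc n) - S) * t ^ Suc n)"
      using sms by (subst summable_Suc_iff)
    have "(\<Sum>n. (s n - S) * t ^ n) - t * (\<Sum>n. (s n - S) * t ^ n)
        = (s 0 - S) + (\<Sum>n. (s (Suc n) - S) * t ^ Suc n) - (\<Sum>n. t * ((s n - S) * t ^ n))"
      using suminf_split_head[OF sms] suminf_mult[OF sms, of t] by simp
    also have "\<dots> = (s 0 - S) + (\<Sum>n. (s (Suc n) - S) * t ^ Suc n - t * ((s n - S) * t ^ n))"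
      using suminf_diff[OF smss summable_mult[OF sms, of t]] by simp
    also have "(\<lambda>n. (s (Suc n) - S) * t ^ Suc n - t * ((s n - S) * t ^ n)) = (\<lambda>n. c (Suc n) * t ^ Suc n)"
      by (auto simp: s_def algebra_simps)
    also have "(\<Sum>n. c (Suc n) * t ^ Suc n) = (\<Sum>n. c n * t ^ n) - c 0"
      using suminf_split_head[OF smc] by simp
    finally show ?thesis
      by (simp add: s_def algebra_simps)
  qed
  have "((\<lambda>t. S + (1 - t) * (\<Sum>n. (s n - S) * t ^ n)) \<longlongrightarrow> S + 0) (at_left 1)"
    by (intro tendsto_intros null_seq_powser_at_left_1 null)
  moreover have "eventually (\<lambda>t::real. 0 < t \<and> t < 1) (at_left 1)"
    by (rule eventually_in_unit_interval)
  then have "eventually (\<lambda>t. S + (1 - t) * (\<Sum>n. (s n - S) * t ^ n) = (\<Sum>n. c n * t ^ n)) (at_left 1)"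
    by eventually_elim (use eq in auto)
  ultimately show ?thesis
    by (simp add: tendsto_cong)
qed

section \<open>Iterated integrals as power series\<close>

text \<open>The constructors stand for the forms \<open>dt/t\<close>, \<open>dt/(1-t)\<close>, \<open>dt/(1+t)\<close> and \<open>dt/(2-t)\<close>.\<close>

datatype form = Om0 | Om1 | OmN | Om2

fun form_fun :: "form \<Rightarrow> real \<Rightarrow> real" where
  "form_fun Om0 t = 1 / t"
| "form_fun Om1 t = 1 / (1 - t)"
| "form_fun OmN t = 1 / (1 + t)"
| "form_fun Om2 t = 1 / (2 - t)"

text \<open>Taylor coefficients at \<open>0\<close>; the value for \<open>Om0\<close>, which has a pole there, is junk.\<close>

fun form_coef :: "form \<Rightarrow> nat \<Rightarrow> real" where
  "form_coef Om0 k = 0"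
| "form_coef Om1 k = 1"
| "form_coef OmN k = (- 1) ^ k"
| "form_coef Om2 k = 1 / 2 ^ Suc k"

text \<open>These are the coefficients of t x(t) G(t). The extra t removes the pole of dt/t and
  makes the division by n in \<open>int_form\<close> a termwise integration.\<close>

definition conv_form :: "form \<Rightarrow> (nat \<Rightarrow> real) \<Rightarrow> nat \<Rightarrow> real" where
  "conv_form x g n = (if x = Om0 then g n else \<Sum>l<n. form_coef x (n - 1 - l) * g l)"

text \<open>\<open>int_form x\<close> sends the coefficients of \<open>G(t)\<close> to those of the integral from \<open>0\<close> to \<open>t\<close> of \<open>G x\<close>;
  the constant term is \<open>0\<close> because of \<open>x / 0 = 0\<close>.\<close>

definition int_form :: "form \<Rightarrow> (nat \<Rightarrow> real) \<Rightarrow> nat \<Rightarrow> real" where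
  "int_form x g n = conv_form x g n / real n"

definition unit_seq :: "nat \<Rightarrow> real" where
  "unit_seq n = (if n = 0 then 1 else 0)"

definition word_coef :: "form list \<Rightarrow> nat \<Rightarrow> real" where
  "word_coef w = foldr int_form w unit_seq"

definition word_fun :: "form list \<Rightarrow> real \<Rightarrow> real" where
  "word_fun w t = (\<Sum>n. word_coef w n * t ^ n)"

lemma word_coef_Nil [simp]: "word_coef [] = unit_seq"
  and word_coef_Cons [simp]: "word_coef (x # w) = int_form x (word_coef w)"
  by (simp_all add: word_coef_def)

lemma int_form_0 [simp]: "int_form x g 0 = 0"
  by (simp add: int_form_def)

lemma word_coef_0: "w \<noteq> [] \<Longrightarrow> word_coef w 0 = 0"
  by (cases w) auto

lemma form_coef_le_1: "\<bar>form_coef x k\<bar> \<le> 1"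
proof (cases x)
  case Om2
  have "1 \<le> (2::real) ^ Suc k" by (rule one_le_power) simp
  then show ?thesis using Om2 by simp
qed (auto simp: power_abs)

lemma conv_form_abs_le:
  assumes "x \<noteq> Om0"
  shows "\<bar>conv_form x g n\<bar> \<le> (\<Sum>l<n. \<bar>g l\<bar>)"
proof -
  have "\<bar>form_coef x (n - 1 - l) * g l\<bar> \<le> \<bar>g l\<bar>" for l
    using mult_right_mono[OF form_coef_le_1[of x "n - 1 - l"], of "\<bar>g l\<bar>"] by (simp add: abs_mult)
  then have "(\<Sum>l<n. \<bar>form_coef x (n - 1 - l) * g l\<bar>) \<le> (\<Sum>l<n. \<bar>g l\<bar>)"
    by (intro sum_mono) auto
  then show ?thesis
    unfolding conv_form_def if_not_P[OF assms]
    using sum_abs[of "\<lambda>l. form_coef x (n - 1 - l) * g l" "{..<n}"] by linarith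
qed

text \<open>A convolution adds n terms of size at most 1, and the division by n undoes this. All
  \<open>word_fun\<close> series therefore converge for |t| < 1.\<close>

lemma word_coef_le_1: "\<bar>word_coef w n\<bar> \<le> 1"
proof (induction w arbitrary: n)
  case Nil
  then show ?case by (simp add: unit_seq_def)
next
  case (Cons x w)
  show ?case
  proof (cases "n = 0")
    case False
    have "\<bar>conv_form x (word_coef w) n\<bar> \<le> real n"
    proof (cases "x = Om0")
      case True
      then show ?thesis
        using Cons[of n] False by (simp add: conv_form_def)
    next
      case x: False
      have "(\<Sum>l<n. \<bar>word_coef w l\<bar>) \<le> (\<Sum>l<n. 1)"
        by (intro sum_mono Cons)
      then show ?thesis
        using conv_form_abs_le[OF x, of "word_coef w" n] by simp
    qed
    then show ?thesis
      using False by (simp add: int_form_def)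
  qed simp
qed

lemma word_fun_summable: "\<bar>t\<bar> < 1 \<Longrightarrow> summable (\<lambda>n. word_coef w n * t ^ n)"
  by (rule summable_bounded_powser[OF word_coef_le_1])

lemma word_fun_Nil [simp]: "word_fun [] t = 1"
proof -
  have "(\<Sum>n. unit_seq n * t ^ n) = (\<Sum>n\<in>{0}. unit_seq n * t ^ n)"
    by (rule suminf_finite) (auto simp: unit_seq_def)
  then show ?thesis by (simp add: word_fun_def unit_seq_def)
qed

text \<open>Multiplication by the denominators 1 - t, 1 + t and 2 - t, read off
  coefficientwise.\<close>

lemma conv_form_Suc:
  "conv_form Om1 g (Suc n) = conv_form Om1 g n + g n"
  "conv_form OmN g (Suc n) = - conv_form OmN g n + g n"
  "conv_form Om2 g (Suc n) = conv_form Om2 g n / 2 + g n / 2"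
proof -
  have "(\<Sum>l<n. (- 1) ^ (n - l) * g l) = - (\<Sum>l<n. (- 1) ^ (n - 1 - l) * g l)"
    unfolding sum_negf[symmetric]
  proof (rule sum.cong)
    fix l assume "l \<in> {..<n}"
    then have "n - l = Suc (n - 1 - l)" by auto
    then show "(- 1) ^ (n - l) * g l = - ((- 1) ^ (n - 1 - l) * g l)" by simp
  qed simp
  then show "conv_form OmN g (Suc n) = - conv_form OmN g n + g n"
    by (simp add: conv_form_def)
  have "(\<Sum>l<n. g l / (2 * 2 ^ (n - l))) = (\<Sum>l<n. g l / (2 * 2 ^ (n - 1 - l))) / 2"
    unfolding sum_divide_distrib
  proof (rule sum.cong)
    fix l assume "l \<in> {..<n}"
    then have "n - l = Suc (n - 1 - l)" by auto
    then show "g l / (2 * 2 ^ (n - l)) = g l / (2 * 2 ^ (n - 1 - l)) / 2" by simp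
  qed simp
  then show "conv_form Om2 g (Suc n) = conv_form Om2 g n / 2 + g n / 2"
    by (simp add: conv_form_def)
qed (simp add: conv_form_def)

lemma conv_form_0: "x \<noteq> Om0 \<Longrightarrow> conv_form x g 0 = 0"
  by (simp add: conv_form_def)

text \<open>By the recurrences of \<open>conv_form_Suc\<close>, the shifted series E satisfies E = q
  t E + r G; solving for E produces the form. For \<open>Om0\<close> the constant term of G must
  vanish, since G/t is to be a power series.\<close>

lemma conv_form_powser:
  assumes "\<bar>t\<bar> < 1" "t \<noteq> 0" and g: "summable (\<lambda>n. g n * t ^ n)"
    and e: "summable (\<lambda>n. conv_form x g (Suc n) * t ^ n)"
    and "x = Om0 \<Longrightarrow> g 0 = 0"
  shows "(\<Sum>n. conv_form x g (Suc n) * t ^ n) = form_fun x t * (\<Sum>n. g n * t ^ n)"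
proof (cases "x = Om0")
  case True
  have "(\<Sum>n. g n * t ^ n) = (\<Sum>n. t * (g (Suc n) * t ^ n))"
    using suminf_split_head[OF g] assms(5) True by (simp add: mult_ac)
  also have "\<dots> = t * (\<Sum>n. g (Suc n) * t ^ n)"
    using e True by (intro suminf_mult) (simp add: conv_form_def)
  finally show ?thesis
    using True assms(2) by (simp add: conv_form_def)
next
  case False
  define E where "E = (\<Sum>n. conv_form x g (Suc n) * t ^ n)"
  have e0: "summable (\<lambda>n. conv_form x g n * t ^ n)"
    by (subst summable_Suc_iff[symmetric]) (use summable_mult[OF e, of t] in \<open>simp add: mult_ac\<close>)
  have E: "(\<Sum>n. conv_form x g n * t ^ n) = t * E"
  proof -
    have "(\<Sum>n. conv_form x g n * t ^ n) = (\<Sum>n. t * (conv_form x g (Suc n) * t ^ n))"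
      using suminf_split_head[OF e0] conv_form_0[OF False] by (simp add: mult_ac)
    then show ?thesis
      using suminf_mult[OF e, of t] by (simp add: E_def)
  qed
  have lin: "E = q * (t * E) + r * (\<Sum>n. g n * t ^ n)"
    if "\<And>n. conv_form x g (Suc n) = q * conv_form x g n + r * g n" for q r
  proof -
    have "E = (\<Sum>n. q * (conv_form x g n * t ^ n) + r * (g n * t ^ n))"
      unfolding E_def that by (simp add: algebra_simps)
    also have "\<dots> = (\<Sum>n. q * (conv_form x g n * t ^ n)) + (\<Sum>n. r * (g n * t ^ n))"
      by (intro suminf_add[symmetric] summable_mult e0 g)
    also have "\<dots> = q * (t * E) + r * (\<Sum>n. g n * t ^ n)"
      by (simp add: suminf_mult[OF e0] suminf_mult[OF g] E)
    finally show ?thesis .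
  qed
  have t: "1 - t \<noteq> 0" "1 + t \<noteq> 0" "2 - t \<noteq> 0"
    using assms(1) by auto
  show ?thesis
  proof (cases x)
    case Om1
    show ?thesis
      using lin[of 1 1] t Om1 unfolding E_def[symmetric]
      by (simp add: conv_form_Suc field_simps)
  next
    case OmN
    show ?thesis
      using lin[of "-1" 1] t OmN unfolding E_def[symmetric]
      by (simp add: conv_form_Suc field_simps)
  next
    case Om2
    show ?thesis
      using lin[of "1/2" "1/2"] t Om2 unfolding E_def[symmetric]
      by (simp add: conv_form_Suc field_simps)
  qed (use False in auto)
qed

lemma has_real_derivative_word_fun:
  assumes "0 < t" "t < 1" and "x = Om0 \<Longrightarrow> w \<noteq> []"
  shows "(word_fun (x # w) has_real_derivative form_fun x t * word_fun w t) (at t)"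
proof -
  define c where "c = word_coef (x # w)"
  \<comment> \<open>Any point strictly between t and 1 serves: termwise differentiation at t uses
    convergence beyond t.\<close>
  define K where "K = (1 + t) / 2"
  have K: "t < K" "K < 1" using assms by (auto simp: K_def)
  have sm: "summable (\<lambda>n. c n * K ^ n)"
    unfolding c_def using K assms by (intro word_fun_summable) auto
  have dc: "diffs c = (\<lambda>n. conv_form x (word_coef w) (Suc n))"
    by (auto simp: diffs_def c_def int_form_def)
  have "((\<lambda>t. \<Sum>n. c n * t ^ n) has_real_derivative (\<Sum>n. diffs c n * t ^ n)) (at t)"
    by (rule termdiffs_strong[OF sm]) (use K assms in auto)
  moreover have "summable (\<lambda>n. diffs c n * t ^ n)"
    by (rule termdiff_converges[where K = K]) (use K assms in \<open>auto simp: c_def simp del: word_coef_Cons intro!: word_fun_summable\<close>)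
  then have "(\<Sum>n. diffs c n * t ^ n) = form_fun x t * word_fun w t"
    unfolding dc word_fun_def using assms
    by (intro conv_form_powser word_fun_summable) (auto simp: word_coef_0)
  ultimately show ?thesis
    by (simp add: c_def word_fun_def[abs_def])
qed

section \<open>Growth of the coefficients\<close>

text \<open>With a and b consecutive square roots, b - a = 1/(b + a) gives 1/b <= 2 (b - a), and the
  right-hand sides telescope.\<close>

lemma sum_inverse_sqrt_le: "(\<Sum>l=1..n. 1 / sqrt (real l)) \<le> 2 * sqrt (real n)"
proof (induction n)
  case (Suc n)
  define a b where "a = sqrt (real n)" and "b = sqrt (real (Suc n))"
  have ab: "a \<ge> 0" "b > a" "b\<^sup>2 = a\<^sup>2 + 1"
    by (auto simp: a_def b_def)
  have "(b - a) * (b + a) = 1"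
    using ab(3) by (simp add: power2_eq_square algebra_simps)
  then have "b - a = 1 / (b + a)"
    using ab by (simp add: field_simps)
  moreover have "2 * (1 / (b + a)) \<ge> 1 / b"
    using ab by (simp add: field_simps)
  ultimately show ?case
    using Suc by (simp add: a_def b_def)
qed simp

text \<open>A crude stand-in for logarithmic bounds: every \<open>int_form\<close> preserves it, and
  one further division by n gives the summable order n^(-3/2). The index 0 is left out because K / 0
  = 0.\<close>

definition sqrt_decay :: "(nat \<Rightarrow> real) \<Rightarrow> bool" where
  "sqrt_decay g \<longleftrightarrow> (\<exists>K. \<forall>n\<ge>1. \<bar>g n\<bar> \<le> K / sqrt (real n))"

lemma sqrt_decay_partial_sums:
  assumes "sqrt_decay g"
  shows "\<exists>K. \<forall>n\<ge>1. (\<Sum>l<n. \<bar>g l\<bar>) \<le> K * sqrt (real n)"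
proof -
  obtain K where K: "\<And>n. n \<ge> 1 \<Longrightarrow> \<bar>g n\<bar> \<le> K / sqrt (real n)"
    using assms by (auto simp: sqrt_decay_def)
  have K0: "K \<ge> 0" using K[of 1] by simp
  have "(\<Sum>l<n. \<bar>g l\<bar>) \<le> (\<bar>g 0\<bar> + 2 * K) * sqrt (real n)" if n: "n \<ge> 1" for n
  proof -
    have "{..<n} = insert 0 {1..<n}" using n by auto
    then have "(\<Sum>l<n. \<bar>g l\<bar>) = \<bar>g 0\<bar> + (\<Sum>l=1..<n. \<bar>g l\<bar>)" by simp
    also have "(\<Sum>l=1..<n. \<bar>g l\<bar>) \<le> (\<Sum>l=1..<n. K * (1 / sqrt (real l)))"
      using K by (intro sum_mono) auto
    also have "\<dots> \<le> (\<Sum>l=1..n. K * (1 / sqrt (real l)))"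
      using K0 by (intro sum_mono2) auto
    also have "\<dots> \<le> K * (2 * sqrt (real n))"
      unfolding sum_distrib_left[symmetric] by (intro mult_left_mono sum_inverse_sqrt_le K0)
    also have "\<bar>g 0\<bar> + K * (2 * sqrt (real n)) \<le> \<bar>g 0\<bar> * sqrt (real n) + K * (2 * sqrt (real n))"
      using n mult_left_mono[of 1 "sqrt (real n)" "\<bar>g 0\<bar>"] by auto
    finally show ?thesis by (simp add: algebra_simps)
  qed
  then show ?thesis by blast
qed

text \<open>Convolution lets partial sums grow like the square root of n, and dividing by n restores
  the decay.\<close>

lemma sqrt_decay_int_form:
  assumes "sqrt_decay g"
  shows "sqrt_decay (int_form x g)"
proof -
  obtain K where K: "\<And>n. n \<ge> 1 \<Longrightarrow> \<bar>g n\<bar> \<le> K / sqrt (real n)"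
    using assms by (auto simp: sqrt_decay_def)
  obtain L where L: "\<And>n. n \<ge> 1 \<Longrightarrow> (\<Sum>l<n. \<bar>g l\<bar>) \<le> L * sqrt (real n)"
    using sqrt_decay_partial_sums[OF assms] by blast
  have "\<bar>int_form x g n\<bar> \<le> max K L / sqrt (real n)" if n: "n \<ge> 1" for n
  proof (cases "x = Om0")
    case True
    have "\<bar>g n\<bar> / real n \<le> \<bar>g n\<bar>"
      using n mult_right_mono[of 1 "real n" "\<bar>g n\<bar>"] by (simp add: field_simps)
    also have "\<dots> \<le> max K L / sqrt (real n)"
      using K[OF n] n by (meson divide_right_mono max.cobounded1 order_trans real_sqrt_ge_zero of_nat_0_le_iff)
    finally show ?thesis
      using True by (simp add: int_form_def conv_form_def)
  next
    case False
    have "\<bar>int_form x g n\<bar> \<le> (\<Sum>l<n. \<bar>g l\<bar>) / real n"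
      using conv_form_abs_le[OF False, of g n] by (simp add: int_form_def divide_right_mono)
    also have "\<dots> \<le> L * sqrt (real n) / real n"
      using L[OF n] by (intro divide_right_mono) auto
    also have "\<dots> = L / sqrt (real n)"
      using n by (metis real_div_sqrt of_nat_0_le_iff times_divide_eq_right divide_divide_eq_right)
    also have "\<dots> \<le> max K L / sqrt (real n)"
      by (intro divide_right_mono) auto
    finally show ?thesis .
  qed
  then show ?thesis by (auto simp: sqrt_decay_def)
qed

lemma sqrt_decay_unit_seq: "sqrt_decay unit_seq"
  by (auto simp: sqrt_decay_def unit_seq_def intro: exI[of _ 0])

lemma sqrt_decay_word_coef: "sqrt_decay (word_coef w)"
  by (induction w) (auto simp: sqrt_decay_unit_seq sqrt_decay_int_form)

lemma sqrt_decay_tendsto_0: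
  assumes "sqrt_decay g"
  shows "g \<longlonglongrightarrow> 0"
proof -
  obtain K where K: "\<And>n. n \<ge> 1 \<Longrightarrow> \<bar>g n\<bar> \<le> K / sqrt (real n)"
    using assms by (auto simp: sqrt_decay_def)
  have "filterlim (\<lambda>n. sqrt (real n)) at_top sequentially"
    by (rule filterlim_compose[OF sqrt_at_top filterlim_real_sequentially])
  then have "(\<lambda>n. K / sqrt (real n)) \<longlonglongrightarrow> 0"
    by (intro tendsto_divide_0[OF tendsto_const] filterlim_at_top_imp_at_infinity)
  then show ?thesis
    by (rule Lim_null_comparison[rotated]) (use K in \<open>auto simp: eventually_at_top_linorder\<close>)
qed

lemma summable_sqrt_decay_div:
  assumes "\<And>n. n \<ge> 1 \<Longrightarrow> \<bar>f n\<bar> \<le> K / (real n * sqrt (real n))"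
  shows "summable (\<lambda>n. f n :: real)"
proof (rule summable_comparison_test)
  have "\<bar>f n\<bar> \<le> K * real n powr (- (3 / 2))" if n: "n \<ge> 1" for n
  proof -
    have "real n powr (3 / 2) = real n powr (1 + 1 / 2)" by simp
    also have "\<dots> = real n * sqrt (real n)"
      using n by (subst powr_add) (simp add: powr_half_sqrt)
    finally have "K * real n powr (- (3 / 2)) = K / (real n * sqrt (real n))"
      by (simp only: powr_minus divide_inverse)
    then show ?thesis using assms[OF n] by simp
  qed
  then show "\<exists>N. \<forall>n\<ge>N. norm (f n) \<le> K * real n powr (- (3 / 2))"
    by auto
  show "summable (\<lambda>n. K * real n powr (- (3 / 2)))"
    by (intro summable_mult) (simp add: summable_real_powr_iff)
qed

lemma summable_int_form_Om0:
  assumes "sqrt_decay g"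
  shows "summable (int_form Om0 g)"
proof -
  obtain K where K: "\<And>n. n \<ge> 1 \<Longrightarrow> \<bar>g n\<bar> \<le> K / sqrt (real n)"
    using assms by (auto simp: sqrt_decay_def)
  have "\<bar>int_form Om0 g n\<bar> \<le> K / (real n * sqrt (real n))" if "n \<ge> 1" for n
    using divide_right_mono[OF K[OF that], of "real n"] by (simp add: int_form_def conv_form_def mult.commute)
  then show ?thesis
    using summable_sqrt_decay_div[of "int_form Om0 g" K] by simp
qed

text \<open>Partial sums of \<open>c\<close> are half those of the paired series, up to the boundary
  terms \<open>c 0\<close> and \<open>c n\<close>.\<close>

lemma summable_if_summable_consecutive:
  fixes c :: "nat \<Rightarrow> real"
  assumes "summable (\<lambda>n. c n + c (Suc n))" "c \<longlonglongrightarrow> 0"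
  shows "summable c"
proof -
  have eq: "(\<Sum>i<n. c i) = ((\<Sum>i<n. c i + c (Suc i)) + c 0 - c n) / 2" for n
    by (induction n) (auto simp: field_simps)
  have "(\<lambda>n. \<Sum>i<n. c i + c (Suc i)) \<longlonglongrightarrow> (\<Sum>i. c i + c (Suc i))"
    using summable_LIMSEQ[OF assms(1)] .
  then have "(\<lambda>n. ((\<Sum>i<n. c i + c (Suc i)) + c 0 - c n) / 2) \<longlonglongrightarrow> ((\<Sum>i. c i + c (Suc i)) + c 0 - 0) / 2"
    by (intro tendsto_intros assms(2)) auto
  then show ?thesis
    unfolding eq[symmetric] by (auto simp: summable_def sums_def)
qed

text \<open>Convergence need not be absolute. The sign in the recurrence makes neighbouring terms
  nearly cancel, leaving sums of order n^(-3/2).\<close>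

lemma summable_int_form_OmN:
  assumes "sqrt_decay g"
  shows "summable (int_form OmN g)"
proof (rule summable_if_summable_consecutive)
  show "int_form OmN g \<longlonglongrightarrow> 0"
    by (intro sqrt_decay_tendsto_0 sqrt_decay_int_form assms)
  obtain K where K: "\<And>n. n \<ge> 1 \<Longrightarrow> \<bar>g n\<bar> \<le> K / sqrt (real n)"
    using assms by (auto simp: sqrt_decay_def)
  obtain L where L: "\<And>n. n \<ge> 1 \<Longrightarrow> (\<Sum>l<n. \<bar>g l\<bar>) \<le> L * sqrt (real n)"
    using sqrt_decay_partial_sums[OF assms] by blast
  have "\<bar>int_form OmN g n + int_form OmN g (Suc n)\<bar> \<le> (K + L) / (real n * sqrt (real n))" if n: "n \<ge> 1" for n
  proof -
    define e where "e = conv_form OmN g n"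
    have "\<bar>e\<bar> \<le> L * sqrt (real n)"
      unfolding e_def using conv_form_abs_le[of OmN g n] L[OF n] by auto
    then have "\<bar>e\<bar> / real n \<le> L * sqrt (real n) / real n"
      by (intro divide_right_mono) auto
    also have "\<dots> = L / sqrt (real n)"
      using n by (metis real_div_sqrt of_nat_0_le_iff times_divide_eq_right divide_divide_eq_right)
    finally have e: "\<bar>e\<bar> / real n \<le> L / sqrt (real n)" .
    \<comment> \<open>The recurrence contributes -e/(n+1), which meets e/n and leaves
      e/(n(n+1)).\<close>
    have "int_form OmN g n + int_form OmN g (Suc n) = (g n + e / real n) / real (Suc n)"
      using n by (simp add: int_form_def conv_form_Suc e_def field_simps)
    also have "\<bar>\<dots>\<bar> = \<bar>g n + e / real n\<bar> / real (Suc n)"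
      by simp
    also have "\<dots> \<le> \<bar>g n + e / real n\<bar> / real n"
      using n by (intro divide_left_mono) auto
    also have "\<dots> \<le> (K / sqrt (real n) + L / sqrt (real n)) / real n"
      using e K[OF n] n by (intro divide_right_mono order_trans[OF abs_triangle_ineq] add_mono) auto
    also have "\<dots> = (K + L) / (real n * sqrt (real n))"
      by (simp add: add_divide_distrib mult.commute)
    finally show ?thesis .
  qed
  then show "summable (\<lambda>n. int_form OmN g n + int_form OmN g (Suc n))"
    by (rule summable_sqrt_decay_div)
qed

section \<open>Duality\<close>

text \<open>Pullback along \<open>t \<mapsto> 1 - t\<close>, with the sign absorbed into the orientation of the path.\<close>

fun dual_form :: "form \<Rightarrow> form" where
  "dual_form Om0 = Om1"
| "dual_form Om1 = Om0"
| "dual_form OmN = Om2"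
| "dual_form Om2 = OmN"

definition dual_word :: "form list \<Rightarrow> form list" where
  "dual_word w = map dual_form (rev w)"

lemma form_fun_dual: "form_fun (dual_form x) (1 - t) = form_fun x t"
  by (cases x) auto

lemma dual_dual_form [simp]: "dual_form (dual_form x) = x"
  by (cases x) auto

lemma dual_dual_word [simp]: "dual_word (dual_word w) = w"
  by (simp add: dual_word_def rev_map o_def)

lemma length_dual_word [simp]: "length (dual_word w) = length w"
  by (simp add: dual_word_def)

lemma dual_word_eq_Nil [simp]: "dual_word w = [] \<longleftrightarrow> w = []"
  by (simp add: dual_word_def)

text \<open>The path composition formula: the integral from \<open>0\<close> to \<open>1\<close> is cut at \<open>t\<close>, and the part from \<open>t\<close>
  to \<open>1\<close> is read backwards as an integral from \<open>0\<close> to \<open>1 - t\<close>.\<close>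

definition path_comp :: "form list \<Rightarrow> real \<Rightarrow> real" where
  "path_comp w t = (\<Sum>j\<le>length w. word_fun (drop j w) t * word_fun (dual_word (take j w)) (1 - t))"

lemma path_comp_dual: "path_comp (dual_word w) t = path_comp w (1 - t)"
proof -
  have "path_comp w (1 - t) = (\<Sum>j\<le>length w. word_fun (drop (length w - j) w) (1 - t)
          * word_fun (dual_word (take (length w - j) w)) t)"
    unfolding path_comp_def
    by (rule sum.reindex_bij_witness[of _ "\<lambda>j. length w - j" "\<lambda>j. length w - j"]) auto
  also have "\<dots> = path_comp (dual_word w) t"
    unfolding path_comp_def
  proof (rule sum.cong)
    fix j assume "j \<in> {..length (dual_word w)}"
    have "drop j (dual_word w) = dual_word (take (length w - j) w)"
      by (simp add: dual_word_def drop_map drop_rev)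
    moreover have "take j (dual_word w) = dual_word (drop (length w - j) w)"
      by (simp add: dual_word_def take_map take_rev)
    ultimately show "word_fun (drop (length w - j) w) (1 - t) * word_fun (dual_word (take (length w - j) w)) t
        = word_fun (drop j (dual_word w)) t * word_fun (dual_word (take j (dual_word w))) (1 - t)"
      by simp
  qed simp
  finally show ?thesis by simp
qed

text \<open>By the product rule, each cut yields a term removing the letter just after it and, with
  opposite sign, one removing the letter just before it. A given letter is thus removed from the
  cuts on both sides of it, and everything cancels. The conditions on the ends of \<open>w\<close>
  keep dt/t from acting on the empty word in either factor.\<close>

lemma path_comp_deriv_0:
  assumes t: "0 < t" "t < 1" and w: "w \<noteq> []" "last w \<noteq> Om0" "hd w \<noteq> Om1"
  shows "(path_comp w has_real_derivative 0) (at t)"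
proof -
  define d where "d = length w"
  define u where "u j = word_fun (drop j w)" for j
  define v where "v j = word_fun (dual_word (take j w))" for j
  define f where "f j = form_fun (w ! j) t" for j
  \<comment> \<open>\<open>a j\<close> is the term removing letter j - 1; it is 0 at both ends of
    the telescoping sum.\<close>
  define a where "a j = (if 1 \<le> j \<and> j \<le> d then f (j - 1) * u j t * v (j - 1) (1 - t) else 0)" for j
  have u: "(u j has_real_derivative (if j < d then f j * u (Suc j) t else 0)) (at t)" for j
  proof (cases "j < d")
    case True
    then have "drop j w = w ! j # drop (Suc j) w"
      by (simp add: Cons_nth_drop_Suc d_def)
    moreover have "drop (Suc j) w \<noteq> []" if "w ! j = Om0"
    proof
      assume "drop (Suc j) w = []"
      then have "j = length w - 1" using True by (simp add: d_def)
      then show False using that w by (simp add: last_conv_nth)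
    qed
    ultimately show ?thesis
      using has_real_derivative_word_fun[OF t, of "w ! j" "drop (Suc j) w"] True
      by (simp add: u_def f_def)
  next
    case False
    then have "u j = (\<lambda>t. 1)" by (auto simp: u_def d_def)
    then show ?thesis using False by simp
  qed
  have v: "((\<lambda>s. v j (1 - s)) has_real_derivative (if 1 \<le> j then - (f (j - 1) * v (j - 1) (1 - t)) else 0)) (at t)"
    if j: "j \<le> d" for j
  proof (cases j)
    case 0
    then show ?thesis by (simp add: v_def dual_word_def)
  next
    case (Suc i)
    then have i: "i < length w" using j by (simp add: d_def)
    have eq: "dual_word (take j w) = dual_form (w ! i) # dual_word (take i w)"
      using i by (simp add: Suc dual_word_def take_Suc_conv_app_nth)
    have ne: "dual_word (take i w) \<noteq> []" if "dual_form (w ! i) = Om0"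
    proof
      assume "dual_word (take i w) = []"
      then have "i = 0" using w by simp
      moreover have "w ! i = Om1" using that by (cases "w ! i") auto
      ultimately show False using w by (simp add: hd_conv_nth)
    qed
    have "(v j has_real_derivative f i * v i (1 - t)) (at (1 - t))"
      using has_real_derivative_word_fun[of "1 - t" "dual_form (w ! i)" "dual_word (take i w)"] ne t
      by (simp add: v_def eq f_def form_fun_dual)
    then have "((\<lambda>s. v j (1 - s)) has_real_derivative (f i * v i (1 - t)) * (- 1)) (at t)"
      by (rule DERIV_chain2) (auto intro!: derivative_eq_intros)
    then show ?thesis by (simp add: Suc)
  qed
  have "((\<lambda>s. u j s * v j (1 - s)) has_real_derivative a (Suc j) - a j) (at t)" if "j \<le> d" for j
  proof -
    have "(if j < d then f j * u (Suc j) t else 0) * v j (1 - t)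
        + (if 1 \<le> j then - (f (j - 1) * v (j - 1) (1 - t)) else 0) * u j t = a (Suc j) - a j"
      using that by (auto simp: a_def algebra_simps)
    then show ?thesis
      using DERIV_mult[OF u[of j] v[OF that]] by simp
  qed
  then have "((\<lambda>s. \<Sum>j\<le>d. u j s * v j (1 - s)) has_real_derivative (\<Sum>j\<le>d. a (Suc j) - a j)) (at t)"
    by (intro DERIV_sum) auto
  moreover have "(\<Sum>j\<le>d. a (Suc j) - a j) = 0"
    using sum_lessThan_telescope[of a "Suc d"] by (simp add: a_def lessThan_Suc_atMost)
  ultimately show ?thesis
    unfolding path_comp_def[abs_def] u_def v_def d_def by simp
qed

text \<open>The reference point 1/2 is the fixed point of the substitution t to 1 - t, so there the
  path compositions of a word and its dual agree.\<close>

lemma path_comp_const: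
  assumes w: "w \<noteq> []" "last w \<noteq> Om0" "hd w \<noteq> Om1" and t: "0 < t" "t < 1"
  shows "path_comp w t = path_comp w (1/2)"
proof -
  have "(path_comp w has_real_derivative 0) (at s within {0<..<1})" if "s \<in> {0<..<1}" for s
    by (rule has_field_derivative_at_within, rule path_comp_deriv_0) (use that w in auto)
  then have "\<exists>c. \<forall>t\<in>{0<..<1}. path_comp w t = c"
    by (intro has_field_derivative_zero_constant) auto
  then show ?thesis using t by auto
qed

text \<open>Since \<open>v\<close> is nonempty, its function at 1 - t has a factor 1 - t, which
  outweighs the growth of \<open>word_fun u\<close>; \<open>h\<close> is the remaining
  cofactor.\<close>

lemma mult_word_fun_tendsto_0:
  assumes "v \<noteq> []"
  shows "((\<lambda>t. word_fun u t * word_fun v (1 - t)) \<longlongrightarrow> 0) (at_left 1)"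
proof -
  have A: "((\<lambda>t. (1 - t) * word_fun u t) \<longlongrightarrow> 0) (at_left 1)"
    unfolding word_fun_def by (intro null_seq_powser_at_left_1 sqrt_decay_tendsto_0 sqrt_decay_word_coef)
  define h where "h s = (\<Sum>n. word_coef v (Suc n) * s ^ n)" for s
  have smh: "summable (\<lambda>n. word_coef v (Suc n) * s ^ n)" if "\<bar>s\<bar> < 1" for s
    by (rule summable_bounded_powser[OF word_coef_le_1 that])
  have v: "word_fun v s = s * h s" if "\<bar>s\<bar> < 1" for s
  proof -
    have "word_fun v s = (\<Sum>n. s * (word_coef v (Suc n) * s ^ n))"
      using suminf_split_head[OF word_fun_summable[OF that, of v]] word_coef_0[OF assms]
      by (simp add: word_fun_def mult_ac)
    then show ?thesis
      using suminf_mult[OF smh[OF that], of s] by (simp add: h_def)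
  qed
  have "isCont h 0"
    unfolding h_def by (rule isCont_powser[where K = "1/2"]) (auto intro!: smh)
  then have "(h \<longlongrightarrow> h 0) (nhds 0)"
    by (simp add: continuous_at tendsto_nhds_iff)
  moreover have "filterlim (\<lambda>t::real. 1 - t) (nhds 0) (at_left 1)"
    by (auto intro!: tendsto_eq_intros)
  ultimately have "((\<lambda>t. h (1 - t)) \<longlongrightarrow> h 0) (at_left 1)"
    by (rule filterlim_compose)
  from tendsto_mult[OF A this]
  have "((\<lambda>t. (1 - t) * word_fun u t * h (1 - t)) \<longlongrightarrow> 0) (at_left 1)" by simp
  moreover have "eventually (\<lambda>t. (1 - t) * word_fun u t * h (1 - t) = word_fun u t * word_fun v (1 - t)) (at_left 1)"
    using eventually_in_unit_interval by eventually_elim (simp add: v)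
  ultimately show ?thesis
    by (simp add: tendsto_cong)
qed

text \<open>As t tends to 1 only the cut j = 0 survives: its second factor is the empty word, and
  Abel's theorem handles the first.\<close>

lemma path_comp_eq_suminf:
  assumes w: "w \<noteq> []" "last w \<noteq> Om0" "hd w \<noteq> Om1" and sm: "summable (word_coef w)"
  shows "path_comp w (1/2) = (\<Sum>n. word_coef w n)"
proof -
  have "((\<lambda>t. \<Sum>j\<le>length w. word_fun (drop j w) t * word_fun (dual_word (take j w)) (1 - t)) \<longlongrightarrow>
          (\<Sum>j\<le>length w. if j = 0 then (\<Sum>n. word_coef w n) else 0)) (at_left 1)"
  proof (intro tendsto_sum)
    fix j assume "j \<in> {..length w}"
    show "((\<lambda>t. word_fun (drop j w) t * word_fun (dual_word (take j w)) (1 - t)) \<longlongrightarrow>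
          (if j = 0 then (\<Sum>n. word_coef w n) else 0)) (at_left 1)"
    proof (cases "j = 0")
      case True
      have "(word_fun w \<longlongrightarrow> (\<Sum>n. word_coef w n)) (at_left 1)"
        unfolding word_fun_def[abs_def] by (rule Abel_limit_at_left_1[OF summable_sums[OF sm]])
      then show ?thesis
        using True by (simp add: dual_word_def)
    next
      case False
      then show ?thesis
        using w mult_word_fun_tendsto_0[of "dual_word (take j w)" "drop j w"] by simp
    qed
  qed
  then have "(path_comp w \<longlongrightarrow> (\<Sum>n. word_coef w n)) (at_left 1)"
    unfolding path_comp_def[abs_def] by (simp add: sum.delta)
  moreover have "eventually (\<lambda>t. path_comp w t = path_comp w (1/2)) (at_left 1)"
    using eventually_in_unit_interval by eventually_elim (rule path_comp_const[OF w], auto)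
  then have "(path_comp w \<longlongrightarrow> path_comp w (1/2)) (at_left 1)"
    by (rule tendsto_eventually)
  ultimately show ?thesis
    by (intro tendsto_unique[of "at_left (1::real)"]) auto
qed

theorem word_coef_duality:
  assumes w: "w \<noteq> []" "last w \<noteq> Om0" "hd w \<noteq> Om1"
    and "summable (word_coef w)" "summable (word_coef (dual_word w))"
  shows "(\<Sum>n. word_coef w n) = (\<Sum>n. word_coef (dual_word w) n)"
proof -
  have "hd (dual_word w) = dual_form (last w)" "last (dual_word w) = dual_form (hd w)"
    using w by (simp_all add: dual_word_def hd_map last_map hd_rev last_rev)
  moreover have "dual_form (last w) \<noteq> Om1" "dual_form (hd w) \<noteq> Om0"
    using w by (cases "last w"; cases "hd w"; simp)+
  ultimately have "path_comp (dual_word w) (1/2) = (\<Sum>n. word_coef (dual_word w) n)"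
    using w by (intro path_comp_eq_suminf assms) auto
  then show ?thesis
    using path_comp_eq_suminf[OF w assms(4)] path_comp_dual[of w "1/2"] by simp
qed

section \<open>Summing out the outer variables\<close>

text \<open>Tonelli for the nonnegative terms \<open>h N * g l\<close> on the triangle l < N, with N
  = l + k + 1 in the new order.\<close>

lemma sums_swap_triangle:
  fixes g h :: "nat \<Rightarrow> real"
  assumes g: "\<And>n. g n \<ge> 0" and h: "\<And>n. h n \<ge> 0" and smh: "summable h"
    and S: "(\<lambda>N. h N * (\<Sum>l<N. g l)) sums S"
  shows "(\<lambda>l. g l * (\<Sum>k. h (Suc (l + k)))) sums S"
proof -
  define f where "f = (\<lambda>(N, l). if l < N then h N * g l else 0)"
  have f0: "f x \<ge> 0" for x
    using g h by (auto simp: f_def split: prod.splits)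
  have row: "((\<lambda>l. f (N, l)) has_sum h N * (\<Sum>l<N. g l)) UNIV" for N
  proof -
    have "((\<lambda>l. f (N, l)) has_sum (\<Sum>l<N. f (N, l))) {..<N}"
      by (rule has_sum_finite) auto
    also have "(\<Sum>l<N. f (N, l)) = h N * (\<Sum>l<N. g l)"
      by (simp add: f_def sum_distrib_left)
    also have "((\<lambda>l. f (N, l)) has_sum h N * (\<Sum>l<N. g l)) {..<N} \<longleftrightarrow> ?thesis"
      by (rule has_sum_cong_neutral) (auto simp: f_def)
    finally show ?thesis .
  qed
  have col: "((\<lambda>N. f (N, l)) has_sum g l * (\<Sum>k. h (Suc (l + k)))) UNIV" for l
  proof -
    have "summable (\<lambda>k. h (k + Suc l))"
      by (rule summable_ignore_initial_segment[OF smh])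
    then have "(\<lambda>k. g l * h (Suc (l + k))) sums (g l * (\<Sum>k. h (Suc (l + k))))"
      by (intro sums_mult summable_sums) (simp add: add.commute)
    then have "(\<lambda>k. f (k + Suc l, l)) sums (g l * (\<Sum>k. h (Suc (l + k))))"
      by (simp add: f_def mult.commute add.commute)
    then have "(\<lambda>N. f (N, l)) sums (g l * (\<Sum>k. h (Suc (l + k))) + (\<Sum>N<Suc l. f (N, l)))"
      by (subst (asm) sums_iff_shift)
    moreover have "(\<Sum>N<Suc l. f (N, l)) = 0"
      by (intro sum.neutral) (auto simp: f_def)
    ultimately show ?thesis
      by (intro sums_nonneg_imp_has_sum f0) simp
  qed
  have Sh: "((\<lambda>N. h N * (\<Sum>l<N. g l)) has_sum S) UNIV"
    by (intro sums_nonneg_imp_has_sum S mult_nonneg_nonneg sum_nonneg g h)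
  have "f summable_on UNIV \<times> UNIV"
    by (rule summable_on_SigmaI[OF row]) (use Sh f0 in \<open>auto simp: has_sum_imp_summable\<close>)
  then have "(f has_sum S) (UNIV \<times> UNIV)"
    by (intro has_sum_SigmaI[OF row Sh])
  then have "((\<lambda>(l, N). f (N, l)) has_sum S) (UNIV \<times> UNIV)"
    by (rule has_sum_swap[THEN iffD1])
  then have "((\<lambda>l. g l * (\<Sum>k. h (Suc (l + k)))) has_sum S) UNIV"
    by (rule has_sum_SigmaD) (use col in auto)
  then show ?thesis
    by (rule has_sum_imp_sums)
qed

text \<open>From here on words in \<open>Om0\<close> and \<open>Om1\<close> are read from the innermost form outwards.
  \<open>tail_sum V n\<close> is the value at \<open>1\<close> of the word \<open>V\<close> applied to the monomial \<open>t\<^sup>n\<close>.\<close>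

fun tail_sum :: "form list \<Rightarrow> nat \<Rightarrow> real" where
  "tail_sum [] n = 1"
| "tail_sum (x # V) n = (if x = Om0 then tail_sum V n / real n
     else \<Sum>k. tail_sum V (Suc (n + k)) / real (Suc (n + k)))"

text \<open>In the outward reading, \<open>last V\<close> is the outermost form; dt/t there makes
  the value at 1 converge.\<close>

definition admissible :: "form list \<Rightarrow> bool" where
  "admissible V \<longleftrightarrow> V \<noteq> [] \<and> last V = Om0 \<and> set V \<subseteq> {Om0, Om1}"

lemma int_form_nonneg:
  assumes "x \<noteq> OmN" "\<And>n. g n \<ge> 0"
  shows "int_form x g n \<ge> 0"
proof -
  have "form_coef x k \<ge> 0" for k
    using assms(1) by (cases x) auto
  then show ?thesis
    using assms(2) by (auto simp: int_form_def conv_form_def intro!: divide_nonneg_nonneg sum_nonneg)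
qed

lemma conv_form_unit_seq: "conv_form Om1 unit_seq n = (if n = 0 then 0 else 1)"
  by (induction n) (auto simp: conv_form_Suc conv_form_0 unit_seq_def)

text \<open>\<open>tail_sum\<close> is adjoint to the integration operators: a letter moves from g
  to the tail, for dt/t by moving a division by n, for dt/(1-t) by exchanging a double sum. The
  exchange uses nonnegativity and summability of the tails, hence the joint induction.\<close>

lemma tail_sum_pairing_aux:
  assumes "admissible V"
  shows "(\<forall>n. tail_sum V n \<ge> 0) \<and> (\<forall>g. (\<forall>n. g n \<ge> 0) \<longrightarrow> sqrt_decay g \<longrightarrow>
           summable (fold int_form V g) \<and> (\<lambda>n. g n * tail_sum V n) sums (\<Sum>n. fold int_form V g n)) \<and>
         (\<forall>U. V = Om1 # U \<longrightarrow> summable (\<lambda>n. tail_sum U n / real n))"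
  using assms
proof (induction V)
  case Nil
  then show ?case by (simp add: admissible_def)
next
  case (Cons x V)
  show ?case
  proof (cases "V = []")
    case True
    then have x: "x = Om0" using Cons.prems by (simp add: admissible_def)
    have "summable (int_form Om0 g)" if "sqrt_decay g" for g
      using summable_int_form_Om0[OF that] .
    moreover have "(\<lambda>n. g n / real n) = int_form Om0 g" for g
      by (auto simp: int_form_def conv_form_def)
    ultimately show ?thesis
      using True x by (auto intro: summable_sums)
  next
    case False
    then have adm: "admissible V" using Cons.prems by (auto simp: admissible_def)
    have nonneg: "tail_sum V n \<ge> 0" for n
      using Cons.IH[OF adm] by blast
    have IH: "summable (fold int_form V g)"
      "(\<lambda>n. g n * tail_sum V n) sums (\<Sum>n. fold int_form V g n)"
      if "\<And>n. g n \<ge> 0" "sqrt_decay g" for g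
      using Cons.IH[OF adm] that by blast+
    have x: "x = Om0 \<or> x = Om1"
      using Cons.prems by (auto simp: admissible_def)
    have IH': "summable (fold int_form (x # V) g)"
      "(\<lambda>n. int_form x g n * tail_sum V n) sums (\<Sum>n. fold int_form (x # V) g n)"
      if "\<And>n. g n \<ge> 0" "sqrt_decay g" for g
    proof -
      have "int_form x g n \<ge> 0" for n
        using that x by (intro int_form_nonneg) auto
      from IH[OF this sqrt_decay_int_form[OF that(2)]]
      show "summable (fold int_form (x # V) g)"
        "(\<lambda>n. int_form x g n * tail_sum V n) sums (\<Sum>n. fold int_form (x # V) g n)"
        by simp_all
    qed
    show ?thesis
    proof (cases "x = Om0")
      case True
      have "int_form Om0 g n * tail_sum V n = g n * (tail_sum V n / real n)" for g n
        by (simp add: int_form_def conv_form_def)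
      then show ?thesis
        using IH' nonneg True by auto
    next
      case False
      then have x: "x = Om1" using x by simp
      \<comment> \<open>Testing the induction hypothesis on \<open>unit_seq\<close> gives this,
        because \<open>int_form Om1 unit_seq\<close> has coefficients 1/n.\<close>
      have sm: "summable (\<lambda>n. tail_sum V n / real n)"
      proof -
        have "summable (\<lambda>n. int_form Om1 unit_seq n * tail_sum V n)"
          using IH'(2)[of unit_seq] x sqrt_decay_unit_seq by (auto simp: unit_seq_def sums_iff)
        moreover have "int_form Om1 unit_seq n * tail_sum V n = tail_sum V n / real n" for n
          by (simp add: int_form_def conv_form_unit_seq)
        ultimately show ?thesis by simp
      qed
      have "(\<lambda>n. g n * tail_sum (x # V) n) sums (\<Sum>n. fold int_form (x # V) g n)"
        if "\<And>n. g n \<ge> 0" "sqrt_decay g" for g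
      proof -
        have "int_form x g n * tail_sum V n = tail_sum V n / real n * (\<Sum>l<n. g l)" for n
          using x by (simp add: int_form_def conv_form_def)
        then have "(\<lambda>n. tail_sum V n / real n * (\<Sum>l<n. g l)) sums (\<Sum>n. fold int_form (x # V) g n)"
          using IH'(2)[OF that] by simp
        from sums_swap_triangle[OF _ _ sm this] that(1) nonneg
        show ?thesis using x by simp
      qed
      moreover have "tail_sum (x # V) n \<ge> 0" for n
      proof -
        have "summable (\<lambda>k. tail_sum V (k + Suc n) / real (k + Suc n))"
          by (rule summable_ignore_initial_segment[OF sm])
        then show ?thesis
          using x nonneg by (auto intro!: suminf_nonneg simp: add.commute)
      qed
      ultimately show ?thesis
        using IH'(1) sm x by (intro conjI allI impI) auto
    qed
  qed
qed

lemma tail_sum_pairing: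
  assumes "admissible V" "\<And>n. g n \<ge> 0" "sqrt_decay g"
  shows "summable (fold int_form V g)"
    and "(\<Sum>n. fold int_form V g n) = (\<Sum>n. g n * tail_sum V n)"
proof -
  have "summable (fold int_form V g) \<and> (\<lambda>n. g n * tail_sum V n) sums (\<Sum>n. fold int_form V g n)"
    using tail_sum_pairing_aux[OF assms(1)] assms(2,3) by blast
  then show "summable (fold int_form V g)" "(\<Sum>n. fold int_form V g n) = (\<Sum>n. g n * tail_sum V n)"
    by (simp_all add: sums_iff)
qed

text \<open>Pairing with \<open>unit_seq\<close> selects n = 0. If V starts with \<open>Om0\<close>,
  both sides are 0 by the convention for division by zero.\<close>

lemma tail_sum_at_0:
  assumes "admissible V"
  shows "tail_sum V 0 = (\<Sum>n. fold int_form V unit_seq n)"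
proof -
  have "(\<Sum>n. unit_seq n * tail_sum V n) = (\<Sum>n\<in>{0}. unit_seq n * tail_sum V n)"
    by (rule suminf_finite) (auto simp: unit_seq_def)
  then show ?thesis
    using tail_sum_pairing(2)[OF assms, of unit_seq] sqrt_decay_unit_seq by (simp add: unit_seq_def)
qed

text \<open>Variables above n are the complement, in the full sum at 0, of those up to n. This is
  the basic step of the splitting.\<close>

lemma tail_sum_Om1:
  assumes "admissible (Om1 # V)"
  shows "tail_sum (Om1 # V) n = tail_sum (Om1 # V) 0 - (\<Sum>l=1..n. tail_sum V l / real l)"
proof -
  have "summable (\<lambda>n. tail_sum V n / real n)"
    using tail_sum_pairing_aux[OF assms] by blast
  then have "summable (\<lambda>k. tail_sum V (Suc k) / real (Suc k))"
    by (subst summable_Suc_iff)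
  from suminf_split_initial_segment[OF this, of n]
  have "tail_sum (Om1 # V) 0 = tail_sum (Om1 # V) n + (\<Sum>l<n. tail_sum V (Suc l) / real (Suc l))"
    by (simp add: add.commute)
  also have "(\<Sum>l<n. tail_sum V (Suc l) / real (Suc l)) = (\<Sum>l=1..n. tail_sum V l / real l)"
    by (rule sum.reindex_bij_witness[of _ "\<lambda>l. l - 1" Suc]) auto
  finally show ?thesis by simp
qed

section \<open>Splitting tails into full sums and star sums\<close>

text \<open>Finite counterpart of \<open>tail_sum\<close>, for the ranges l <= n left by taking
  complements; \<open>h\<close> carries the part of the word not yet split.\<close>

fun star_op :: "form list \<Rightarrow> (nat \<Rightarrow> real) \<Rightarrow> nat \<Rightarrow> real" where
  "star_op [] h n = h n"
| "star_op (x # V) h n = (if x = Om0 then star_op V h n / real n else \<Sum>l=1..n. star_op V h l / real l)"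

lemma star_op_append: "star_op (U @ V) h = star_op U (star_op V h)"
proof
  show "star_op (U @ V) h n = star_op U (star_op V h) n" for n
    by (induction U arbitrary: n) auto
qed

lemma star_op_add: "star_op V (\<lambda>n. h n + k n) n = star_op V h n + star_op V k n"
  by (induction V arbitrary: n) (auto simp: add_divide_distrib sum.distrib)

lemma star_op_mult: "star_op V (\<lambda>n. c * h n) n = c * star_op V h n"
  by (induction V arbitrary: n) (auto simp: sum_distrib_left)

lemma star_op_sum: "star_op V (\<lambda>n. \<Sum>j\<in>J. h j n) n = (\<Sum>j\<in>J. star_op V (h j) n)"
proof (induction V arbitrary: n)
  case (Cons x V)
  have "(\<Sum>l=1..n. \<Sum>j\<in>J. star_op V (h j) l / real l) = (\<Sum>j\<in>J. \<Sum>l=1..n. star_op V (h j) l / real l)"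
    by (rule sum.swap)
  then show ?case by (simp add: Cons sum_divide_distrib)
qed simp

lemma tail_sum_Om0_power: "tail_sum (replicate q Om0 @ V) = star_op (replicate q Om0) (tail_sum V)"
proof
  show "tail_sum (replicate q Om0 @ V) n = star_op (replicate q Om0) (tail_sum V) n" for n
    by (induction q) auto
qed

text \<open>Each use of \<open>tail_sum_Om1\<close> splits off a full sum and turns one
  \<open>Om1\<close> into a star summation with sign -1.\<close>

lemma tail_sum_Om1_power:
  assumes "admissible V"
  shows "tail_sum (replicate q Om1 @ V) n =
    (\<Sum>j<q. (- 1) ^ j * tail_sum (replicate (q - j) Om1 @ V) 0 * star_op (replicate j Om1) (\<lambda>_. 1) n)
    + (- 1) ^ q * star_op (replicate q Om1) (tail_sum V) n"
proof (induction q arbitrary: n)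
  case (Suc q)
  have adm: "admissible (Om1 # replicate q Om1 @ V)"
    using assms by (auto simp: admissible_def)
  define c where "c j = (- 1) ^ j * tail_sum (replicate (q - j) Om1 @ V) 0" for j
  have IH: "tail_sum (replicate q Om1 @ V) = (\<lambda>l. (\<Sum>j<q. c j * star_op (replicate j Om1) (\<lambda>_. 1) l)
        + (- 1) ^ q * star_op (replicate q Om1) (tail_sum V) l)"
    using Suc.IH by (auto simp: c_def)
  have "(\<Sum>l=1..n. tail_sum (replicate q Om1 @ V) l / real l)
      = star_op [Om1] (tail_sum (replicate q Om1 @ V)) n"
    by simp
  also have "\<dots> = (\<Sum>j<q. c j * star_op (replicate (Suc j) Om1) (\<lambda>_. 1) n)
        + (- 1) ^ q * star_op (replicate (Suc q) Om1) (tail_sum V) n"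
    unfolding IH star_op_add star_op_sum star_op_mult by simp
  finally have *: "(\<Sum>l=1..n. tail_sum (replicate q Om1 @ V) l / real l) = \<dots>" .
  \<comment> \<open>The full sum split off now is the term j = 0; the induction hypothesis, with one
    more star letter, supplies the others, shifted by one.\<close>
  show ?case
    unfolding replicate_Suc append_Cons tail_sum_Om1[OF adm, of n] *
    by (subst sum.lessThan_Suc_shift) (simp add: c_def sum_negf)
qed simp

text \<open>The ratio 3/2 has to exceed 1 and stay below 2, the weights being of size 2^(-n); the
  factor 3 compares a geometric sum of this ratio with its last term.\<close>

lemma star_op_geometric_bound: "\<bar>star_op V (\<lambda>_. 1) n\<bar> \<le> 3 ^ length V * (3 / 2) ^ n"
proof (induction V arbitrary: n)
  case (Cons x V)
  have div_le: "\<bar>a\<bar> / real l \<le> \<bar>a\<bar>" for a :: real and l :: nat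
    using mult_left_mono[of 1 "real l" "\<bar>a\<bar>"] by (cases "l = 0") (auto simp: field_simps)
  have geo: "(\<Sum>l=1..n. (3 / 2) ^ l) \<le> 3 * (3 / 2 :: real) ^ n" for n :: nat
    by (induction n) auto
  show ?case
  proof (cases "x = Om0")
    case True
    have "\<bar>star_op V (\<lambda>_. 1) n\<bar> / real n \<le> 3 ^ length V * (3 / 2) ^ n"
      using div_le[of "star_op V (\<lambda>_. 1) n" n] Cons[of n] by linarith
    also have "\<dots> \<le> 3 * (3 ^ length V * (3 / 2) ^ n)"
      by simp
    finally show ?thesis using True by simp
  next
    case False
    have "\<bar>\<Sum>l=1..n. star_op V (\<lambda>_. 1) l / real l\<bar> \<le> (\<Sum>l=1..n. \<bar>star_op V (\<lambda>_. 1) l / real l\<bar>)"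
      by (rule sum_abs)
    also have "\<dots> \<le> (\<Sum>l=1..n. 3 ^ length V * (3 / 2) ^ l)"
    proof (rule sum_mono)
      fix l
      show "\<bar>star_op V (\<lambda>_. 1) l / real l\<bar> \<le> 3 ^ length V * (3 / 2) ^ l"
        using div_le[of "star_op V (\<lambda>_. 1) l" l] Cons[of l] by simp
    qed
    also have "\<dots> \<le> 3 ^ length V * (3 * (3 / 2) ^ n)"
      unfolding sum_distrib_left[symmetric] by (intro mult_left_mono geo) auto
    finally show ?thesis using False by simp
  qed
qed auto

section \<open>Multiple harmonic sums\<close>

lemma finite_decr_tuples [simp]: "finite (decr_tuples N d)"
  by (rule finite_subset[OF _ finite_lists_length_eq[of "{1..N}" d]]) (auto simp: decr_tuples_def)

lemma finite_weak_decr_tuples [simp]: "finite (weak_decr_tuples N d)"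
  by (rule finite_subset[OF _ finite_lists_length_eq[of "{1..N}" d]]) (auto simp: weak_decr_tuples_def)

lemma decr_tuples_0 [simp]: "decr_tuples N 0 = {[]}"
  by (auto simp: decr_tuples_def)

lemma weak_decr_tuples_0 [simp]: "weak_decr_tuples N 0 = {[]}"
  by (auto simp: weak_decr_tuples_def)

lemma sum_decr_tuples_Suc:
  fixes F :: "nat list \<Rightarrow> real"
  shows "(\<Sum>ns\<in>decr_tuples N (Suc d). F ns) = (\<Sum>n=1..N. \<Sum>ns\<in>decr_tuples (n - 1) d. F (n # ns))"
proof -
  have "(\<Sum>n=1..N. \<Sum>ns\<in>decr_tuples (n - 1) d. F (n # ns))
      = (\<Sum>(n, ns)\<in>(SIGMA n:{1..N}. decr_tuples (n - 1) d). F (n # ns))"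
    by (rule sum.Sigma) auto
  also have "\<dots> = (\<Sum>ns\<in>decr_tuples N (Suc d). F ns)"
    by (rule sum.reindex_bij_witness[of _ "\<lambda>ns. (hd ns, tl ns)" "\<lambda>(n, ns). n # ns"])
       (fastforce simp: decr_tuples_def length_Suc_conv)+
  finally show ?thesis by simp
qed

lemma sum_weak_decr_tuples_Suc:
  fixes F :: "nat list \<Rightarrow> real"
  shows "(\<Sum>ns\<in>weak_decr_tuples N (Suc d). F ns) = (\<Sum>n=1..N. \<Sum>ns\<in>weak_decr_tuples n d. F (n # ns))"
proof -
  have "(\<Sum>n=1..N. \<Sum>ns\<in>weak_decr_tuples n d. F (n # ns))
      = (\<Sum>(n, ns)\<in>(SIGMA n:{1..N}. weak_decr_tuples n d). F (n # ns))"
    by (rule sum.Sigma) auto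
  also have "\<dots> = (\<Sum>ns\<in>weak_decr_tuples N (Suc d). F ns)"
    by (rule sum.reindex_bij_witness[of _ "\<lambda>ns. (hd ns, tl ns)" "\<lambda>(n, ns). n # ns"])
       (fastforce simp: weak_decr_tuples_def length_Suc_conv)+
  finally show ?thesis by simp
qed

lemma mhs_Nil [simp]: "mhs N [] = 1"
  by (simp add: mhs_def)

lemma mhs_star_Nil [simp]: "mhs_star N [] = 1"
  by (simp add: mhs_star_def)

lemma alt_mhs_Nil [simp]: "alt_mhs N [] = 1"
  by (simp add: alt_mhs_def)

lemma mhs_Cons: "mhs N (s # ss) = (\<Sum>n=1..N. mhs (n - 1) ss / real n ^ s)"
  by (simp add: mhs_def sum_decr_tuples_Suc prod.lessThan_Suc_shift sum_divide_distrib
           del: prod.lessThan_Suc)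

lemma mhs_star_Cons: "mhs_star N (s # ss) = (\<Sum>n=1..N. mhs_star n ss / real n ^ s)"
  by (simp add: mhs_star_def sum_weak_decr_tuples_Suc prod.lessThan_Suc_shift sum_divide_distrib
           del: prod.lessThan_Suc)

lemma alt_mhs_Cons:
  "alt_mhs N (s # ss) = (\<Sum>n=1..N. of_int (sgn s) ^ n * alt_mhs (n - 1) ss / real n ^ nat \<bar>s\<bar>)"
  by (simp add: alt_mhs_def sum_decr_tuples_Suc prod.lessThan_Suc_shift sum_divide_distrib
        sum_distrib_left del: prod.lessThan_Suc)

section \<open>Words of indices and their coefficients\<close>

definition index_word :: "nat list \<Rightarrow> form list" where
  "index_word ss = concat (map (\<lambda>s. replicate (s - 1) Om0 @ [Om1]) ss)"

lemma index_word_Nil [simp]: "index_word [] = []"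
  and index_word_Cons: "index_word (s # ss) = replicate (s - 1) Om0 @ Om1 # index_word ss"
  and index_word_append: "index_word (ss @ ts) = index_word ss @ index_word ts"
  by (simp_all add: index_word_def)

lemma index_word_ones: "index_word (replicate j (Suc 0)) = replicate j Om1"
  by (induction j) (auto simp: index_word_Cons)

lemma word_coef_Om0_power: "word_coef (replicate q Om0 @ w) n = word_coef w n / real n ^ q"
  by (induction q) (auto simp: int_form_def conv_form_def mult.commute)

lemma word_coef_index_Cons:
  assumes "s \<ge> 1"
  shows "word_coef (index_word (s # ss)) n = (\<Sum>l<n. word_coef (index_word ss) l) / real n ^ s"
proof -
  obtain r where "s = Suc r" using assms by (cases s) auto
  then show ?thesis
    by (simp add: index_word_Cons word_coef_Om0_power int_form_def conv_form_def)
qed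

lemma sum_atMost_eq_sum_from_1:
  fixes f :: "nat \<Rightarrow> real"
  assumes "f 0 = 0"
  shows "(\<Sum>l\<le>N. f l) = (\<Sum>l=1..N. f l)"
  using assms by (simp add: atMost_atLeast0 sum.atLeast_Suc_atMost)

text \<open>The n-th coefficient collects the summands with largest variable n, so partial sums are
  exactly the truncations defining \<open>alt_mzv\<close>.\<close>

lemma sum_word_coef_index:
  assumes "\<forall>s\<in>set ss. s \<ge> 1"
  shows "(\<Sum>l\<le>N. word_coef (index_word ss) l) = alt_mhs N (map int ss)"
  using assms
proof (induction ss arbitrary: N)
  case Nil
  show ?case by (simp add: unit_seq_def)
next
  case (Cons s ss)
  have s: "s \<ge> 1" using Cons.prems by simp
  have "word_coef (index_word (s # ss)) 0 = 0"
    by (rule word_coef_0) (simp add: index_word_Cons)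
  then have "(\<Sum>l\<le>N. word_coef (index_word (s # ss)) l) = (\<Sum>l=1..N. word_coef (index_word (s # ss)) l)"
    by (rule sum_atMost_eq_sum_from_1)
  also have "\<dots> = (\<Sum>l=1..N. alt_mhs (l - 1) (map int ss) / real l ^ s)"
  proof (rule sum.cong)
    fix l assume "l \<in> {1..N}"
    then have "{..<l} = {..l - 1}" by auto
    then show "word_coef (index_word (s # ss)) l = alt_mhs (l - 1) (map int ss) / real l ^ s"
      using Cons by (simp add: word_coef_index_Cons[OF s])
  qed simp
  also have "\<dots> = alt_mhs N (map int (s # ss))"
    using s by (simp add: alt_mhs_Cons)
  finally show ?case .
qed

lemma alt_mzv_eq_suminf:
  assumes "\<And>N. alt_mhs N ss = (\<Sum>l\<le>N. f l)" "summable f"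
  shows "alt_mzv ss = (\<Sum>n. f n)"
  unfolding alt_mzv_def assms(1) by (intro limI summable_LIMSEQ' assms)

lemma conv_form_OmN: "conv_form OmN g n = (\<Sum>l<n. (- 1) ^ (n - 1) * ((- 1) ^ l * g l))"
  unfolding conv_form_def
proof (simp, rule sum.cong)
  fix l assume "l \<in> {..<n}"
  then have "n - Suc 0 = (n - Suc l) + l" by auto
  then have "(- 1 :: real) ^ (n - Suc 0) = (- 1) ^ (n - Suc l) * (- 1) ^ l"
    by (metis power_add)
  then have "(- 1) ^ (n - Suc 0) * ((- 1) ^ l * g l) = (- 1) ^ (n - Suc l) * ((- 1) ^ l * (- 1) ^ l) * g l"
    by (simp only: mult.assoc)
  also have "(- 1 :: real) ^ l * (- 1) ^ l = 1"
    by (simp flip: power_mult_distrib)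
  finally show "(- 1) ^ (n - Suc l) * g l = (- 1) ^ (n - Suc 0) * ((- 1) ^ l * g l)"
    by (simp only: mult_1_right)
qed simp

text \<open>By \<open>conv_form_OmN\<close>, each dt/(1+t) puts a sign on its outer and its inner
  variable. Signs on a variable shared by two such forms cancel, so only the outermost one, through
  (-1)^n, and the first one after the block, through \<open>- int s\<close>, keep theirs. Every form
  adds a factor -1.\<close>

lemma word_coef_OmN_power:
  assumes "s \<ge> 1" "\<forall>s\<in>set ss. s \<ge> 1" "n \<ge> 1"
  shows "word_coef (replicate (Suc q) OmN @ index_word (s # ss)) n =
    (- 1) ^ Suc q * (- 1) ^ n / real n * alt_mhs (n - 1) (replicate q 1 @ - int s # map int ss)"
  using assms(3)
proof (induction q arbitrary: n)
  case 0
  have "(- 1) ^ l * word_coef (index_word (s # ss)) l = (- 1) ^ l * alt_mhs (l - 1) (map int ss) / real l ^ s"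
    if "l \<ge> 1" for l
  proof -
    have "{..<l} = {..l - 1}" using that by auto
    then show ?thesis
      using assms by (simp add: word_coef_index_Cons sum_word_coef_index)
  qed
  moreover have "word_coef (index_word (s # ss)) 0 = 0"
    by (rule word_coef_0) (simp add: index_word_Cons)
  moreover have "{..<n} = {..n - 1}" using 0 by auto
  ultimately have "(\<Sum>l<n. (- 1) ^ l * word_coef (index_word (s # ss)) l) = alt_mhs (n - 1) (- int s # map int ss)"
    using assms(1) by (simp add: sum_atMost_eq_sum_from_1 alt_mhs_Cons)
  then have "conv_form OmN (word_coef (index_word (s # ss))) n
      = (- 1) ^ (n - 1) * alt_mhs (n - 1) (- int s # map int ss)"
    unfolding conv_form_OmN sum_distrib_left[symmetric] by simp
  moreover obtain n' where "n = Suc n'" using 0 by (cases n) auto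
  ultimately show ?case
    by (simp add: int_form_def)
next
  case (Suc q)
  define w where "w = replicate (Suc q) OmN @ index_word (s # ss)"
  have "(- 1) ^ l * word_coef w l
      = (- 1) ^ Suc q * (alt_mhs (l - 1) (replicate q 1 @ - int s # map int ss) / real l)" if "l \<ge> 1" for l
  proof -
    have "(- 1 :: real) ^ l * (- 1) ^ l = 1"
      by (simp add: power_mult_distrib[symmetric])
    moreover have "(- 1) ^ l * ((- 1) ^ Suc q * (- 1) ^ l / real l * x)
        = ((- 1) ^ l * (- 1) ^ l) * ((- 1) ^ Suc q * (x / real l))" for x
      by (simp only: mult_ac times_divide_eq_right times_divide_eq_left)
    ultimately have "(- 1) ^ l * ((- 1) ^ Suc q * (- 1) ^ l / real l * x) = (- 1) ^ Suc q * (x / real l)" for x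
      by (simp only: mult_1)
    then show ?thesis
      unfolding w_def Suc.IH[OF that] .
  qed
  moreover have "word_coef w 0 = 0"
    by (rule word_coef_0) (simp add: w_def)
  moreover have "{..<n} = {..n - 1}" using Suc.prems by auto
  ultimately have "(\<Sum>l<n. (- 1) ^ l * word_coef w l)
      = (- 1) ^ Suc q * alt_mhs (n - 1) (replicate (Suc q) 1 @ - int s # map int ss)"
    by (simp add: sum_atMost_eq_sum_from_1 alt_mhs_Cons sum_negf sum_distrib_left)
  then have "conv_form OmN (word_coef w) n
      = (- 1) ^ (n - 1) * ((- 1) ^ Suc q * alt_mhs (n - 1) (replicate (Suc q) 1 @ - int s # map int ss))"
    unfolding conv_form_OmN sum_distrib_left[symmetric] by simp
  moreover obtain n' where "n = Suc n'" using Suc.prems by (cases n) auto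
  moreover have "word_coef (replicate (Suc (Suc q)) OmN @ index_word (s # ss)) = int_form OmN (word_coef w)"
    by (simp add: w_def)
  ultimately show ?case
    by (simp add: int_form_def mult_ac)
qed

lemma sum_word_coef_OmN_power:
  assumes "s \<ge> 1" "\<forall>s\<in>set ss. s \<ge> 1"
  shows "(\<Sum>l\<le>N. word_coef (replicate (Suc q) OmN @ index_word (s # ss)) l) =
    (- 1) ^ Suc q * alt_mhs N (- 1 # replicate q 1 @ - int s # map int ss)"
proof -
  have "word_coef (replicate (Suc q) OmN @ index_word (s # ss)) 0 = 0"
    by (rule word_coef_0) simp
  then have "(\<Sum>l\<le>N. word_coef (replicate (Suc q) OmN @ index_word (s # ss)) l)
      = (\<Sum>l=1..N. word_coef (replicate (Suc q) OmN @ index_word (s # ss)) l)"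
    by (rule sum_atMost_eq_sum_from_1)
  also have "\<dots> = (\<Sum>l=1..N. (- 1) ^ Suc q * ((- 1) ^ l * alt_mhs (l - 1) (replicate q 1 @ - int s # map int ss) / real l))"
    using word_coef_OmN_power[OF assms] by (intro sum.cong) (auto simp: mult_ac)
  also have "\<dots> = (- 1) ^ Suc q * alt_mhs N (- 1 # replicate q 1 @ - int s # map int ss)"
    unfolding sum_distrib_left[symmetric] alt_mhs_Cons[of N "- 1"] by simp
  finally show ?thesis .
qed

lemma word_coef_Om1_power: "word_coef (replicate (Suc q) Om1) (Suc n) = mhs n (replicate q 1) / real (Suc n)"
proof (induction q arbitrary: n)
  case 0
  show ?case by (simp add: int_form_def conv_form_unit_seq)
next
  case (Suc q)
  have "(\<Sum>l<Suc n. word_coef (replicate (Suc q) Om1) l) = (\<Sum>l=1..n. word_coef (replicate (Suc q) Om1) l)"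
    unfolding lessThan_Suc_atMost by (rule sum_atMost_eq_sum_from_1) simp
  also have "\<dots> = (\<Sum>l=1..n. mhs (l - 1) (replicate q 1) / real l)"
  proof (rule sum.cong)
    fix l assume "l \<in> {1..n}"
    then obtain l' where "l = Suc l'" by (cases l) auto
    then show "word_coef (replicate (Suc q) Om1) l = mhs (l - 1) (replicate q 1) / real l"
      using Suc.IH[of l'] by simp
  qed simp
  also have "\<dots> = mhs n (replicate (Suc q) 1)"
    by (simp add: mhs_Cons)
  finally have "conv_form Om1 (word_coef (replicate (Suc q) Om1)) (Suc n) = mhs n (replicate (Suc q) 1)"
    by (simp add: conv_form_def)
  then show ?case
    by (simp add: int_form_def)
qed

text \<open>Scaling t to t/2 turns dt/(1-t) into dt/(2-t).\<close>

lemma word_coef_Om2_power: "word_coef (replicate q Om2) n = word_coef (replicate q Om1) n / 2 ^ n"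
proof (induction q arbitrary: n)
  case 0
  show ?case by (simp add: unit_seq_def)
next
  case (Suc q)
  have "conv_form Om2 (word_coef (replicate q Om2)) n = conv_form Om1 (word_coef (replicate q Om1)) n / 2 ^ n"
    unfolding conv_form_def
  proof (simp add: sum_divide_distrib, rule sum.cong)
    fix l assume "l \<in> {..<n}"
    then have "n = Suc (n - Suc l) + l" by auto
    then have "(2::real) ^ n = 2 * 2 ^ (n - Suc l) * 2 ^ l"
      by (metis power_Suc power_add)
    then show "word_coef (replicate q Om2) l / (2 * 2 ^ (n - Suc l)) = word_coef (replicate q Om1) l / 2 ^ n"
      using Suc.IH[of l] by simp
  qed simp
  then show ?case
    by (simp add: int_form_def)
qed

section \<open>Box strings\<close>

text \<open>Read from the outermost form this encodes the indices E, read from the innermost form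
  the star sums of F.\<close>

definition box_word :: "(nat \<times> nat) list \<Rightarrow> form list" where
  "box_word ps = concat (map (\<lambda>(p, v). replicate p Om1 @ replicate (v - 1) Om0) ps)"

lemma box_word_Nil [simp]: "box_word [] = []"
  and box_word_Cons: "box_word ((p, v) # ps) = replicate p Om1 @ replicate (v - 1) Om0 @ box_word ps"
  by (simp_all add: box_word_def)

lemma box_string_pos:
  assumes "u \<ge> 1" "\<forall>x\<in>set ps. snd x \<ge> 1" "s \<in> set (box_string u ps)"
  shows "s \<ge> 1"
  using assms by (induction u ps rule: box_string.induct) (auto split: if_splits)

text \<open>In words the convention for p = 0 is plain concatenation: u - 1 and v - 1 letters
  \<open>Om0\<close> become adjacent, just as many as the merged entry u + v - 1 demands.\<close>

lemma index_word_box_string: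
  assumes "u \<ge> 1" "\<forall>x\<in>set ps. snd x \<ge> 1"
  shows "index_word (box_string u ps) = replicate (u - 1) Om0 @ box_word ps @ [Om1]"
  using assms
proof (induction u ps rule: box_string.induct)
  case (1 u)
  show ?case by (simp add: index_word_Cons)
next
  case (2 u p v ps)
  have v: "v \<ge> 1" using "2.prems" by simp
  show ?case
  proof (cases "p = 0")
    case True
    obtain u' v' where "u = Suc u'" "v = Suc v'"
      using v "2.prems" by (cases u; cases v) auto
    then show ?thesis
      using 2 True by (simp add: box_word_Cons replicate_add)
  next
    case False
    then obtain q where "p = Suc q" by (cases p) auto
    then show ?thesis
      using 2 v by (simp add: box_word_Cons index_word_Cons index_word_append index_word_ones)
  qed
qed

lemma star_op_ones: "star_op (replicate j Om1) (\<lambda>_. 1) n = mhs_star n (replicate j (Suc 0))"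
  by (induction j arbitrary: n) (auto simp: mhs_star_Cons)

lemma star_op_Om0_power: "star_op (replicate q Om0 @ V) h n = star_op V h n / real n ^ q"
  by (induction q) (auto simp: mult.commute)

lemma lead_star_Cons:
  assumes "n \<ge> 1" "y \<ge> 1"
  shows "lead_star n (y # ys) = mhs_star n ys / real n ^ (y - 1)"
proof -
  have "1 - int y = - int (y - 1)" using assms by simp
  then have "real n powi (1 - int y) = 1 / real n ^ (y - 1)"
    by (simp only: power_int_minus power_int_of_nat inverse_eq_divide)
  then show ?thesis by (simp add: lead_star_def)
qed

text \<open>The lead factor l^(1-y) times 1/l is l^(-y), so summing with one \<open>Om1\<close>
  makes the leading entry y an ordinary one; the other \<open>q\<close> letters are the preceding
  ones.\<close>

lemma mhs_star_lead:
  assumes "ys \<noteq> []" "hd ys \<ge> 1" "\<And>l. l \<ge> 1 \<Longrightarrow> lead_star l ys = star_op V (\<lambda>_. 1) l"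
  shows "mhs_star n (replicate q (Suc 0) @ ys) = star_op (replicate (Suc q) Om1 @ V) (\<lambda>_. 1) n"
proof (induction q arbitrary: n)
  case 0
  obtain y zs where ys: "ys = y # zs" "y \<ge> 1" using assms by (cases ys) auto
  have "mhs_star l zs / real l ^ y = star_op V (\<lambda>_. 1) l / real l" if "l \<in> {1..n}" for l
  proof -
    obtain y' where "y = Suc y'" using ys by (cases y) auto
    moreover from this have "mhs_star l zs / real l ^ y' = star_op V (\<lambda>_. 1) l"
      using lead_star_Cons[of l y zs] assms(3)[of l] that ys by simp
    moreover have "mhs_star l zs / real l ^ Suc y' = (mhs_star l zs / real l ^ y') / real l"
      by simp
    ultimately show ?thesis by simp
  qed
  then show ?case
    by (simp add: ys mhs_star_Cons)
next
  case (Suc q)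
  then show ?case by (simp add: mhs_star_Cons)
qed

lemma lead_star_box_string:
  assumes "u \<ge> 1" "\<forall>x\<in>set ps. snd x \<ge> 1" "n \<ge> 1"
  shows "lead_star n (box_string u ps @ replicate j (Suc 0)) =
    star_op (box_word ps @ replicate j Om1) (\<lambda>_. 1) n / real n ^ (u - 1)"
  using assms
proof (induction u ps arbitrary: n rule: box_string.induct)
  case (1 u)
  then show ?case
    by (simp add: lead_star_Cons star_op_ones)
next
  case (2 u p v ps)
  have v: "v \<ge> 1" "u \<ge> 1" using "2.prems" by simp_all
  show ?case
  proof (cases "p = 0")
    case True
    obtain u' v' where "u = Suc u'" "v = Suc v'"
      using v by (cases u; cases v) auto
    then show ?thesis
      using 2 True by (simp add: box_word_Cons star_op_Om0_power power_add mult.commute)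
  next
    case False
    then obtain q where q: "p = Suc q" by (cases p) auto
    define ys where "ys = box_string v ps @ replicate j (Suc 0)"
    have ne: "box_string v ps \<noteq> []"
      by (induction v ps rule: box_string.induct) auto
    have "hd ys \<in> set (box_string v ps)"
      using ne by (simp add: ys_def)
    then have hd: "hd ys \<ge> 1"
      using box_string_pos[of v ps] 2 by auto
    have "lead_star l ys = star_op (replicate (v - 1) Om0 @ box_word ps @ replicate j Om1) (\<lambda>_. 1) l"
      if "l \<ge> 1" for l
      unfolding ys_def using 2 False that v by (simp add: star_op_Om0_power)
    then have "mhs_star n (replicate q (Suc 0) @ ys)
        = star_op (replicate (Suc q) Om1 @ replicate (v - 1) Om0 @ box_word ps @ replicate j Om1) (\<lambda>_. 1) n"
      using ne hd by (intro mhs_star_lead) (auto simp: ys_def)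
    then show ?thesis
      using "2.prems" q by (simp add: lead_star_Cons box_word_Cons ys_def)
  qed
qed

section \<open>Block words\<close>

text \<open>Dual of the word behind its power of dt/(1+t), innermost form first. Block l is dual to
  p_l forms dt/t followed by m_(l+1) forms dt/(1-t). The range excludes k, so the full word is
  \<open>blocks p m 1 (Suc k)\<close>.\<close>

definition blocks :: "(nat \<Rightarrow> nat) \<Rightarrow> (nat \<Rightarrow> nat) \<Rightarrow> nat \<Rightarrow> nat \<Rightarrow> form list" where
  "blocks p m i k = concat (map (\<lambda>l. replicate (p l) Om1 @ replicate (m (l + 1)) Om0) [i..<k])"

lemma blocks_same [simp]: "blocks p m k k = []"
  by (simp add: blocks_def)

lemma blocks_Suc: "i \<le> k \<Longrightarrow> blocks p m i (Suc k) = blocks p m i k @ replicate (p k) Om1 @ replicate (m (k + 1)) Om0"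
  by (simp add: blocks_def)

lemma blocks_rec: "i < k \<Longrightarrow> blocks p m i k = replicate (p i) Om1 @ replicate (m (i + 1)) Om0 @ blocks p m (Suc i) k"
  by (simp add: blocks_def upt_rec[of i k])

lemma set_blocks: "set (blocks p m i k) \<subseteq> {Om0, Om1}"
  by (auto simp: blocks_def)

lemma admissible_append_Om1: "admissible V \<Longrightarrow> admissible (replicate q Om1 @ V)"
  by (auto simp: admissible_def)

lemma admissible_blocks:
  assumes "i \<le> k" "m (k + 1) \<ge> 1"
  shows "admissible (replicate (m (i + 1)) Om0 @ blocks p m (Suc i) (Suc k))"
proof (cases "i = k")
  case True
  then show ?thesis using assms by (auto simp: admissible_def)
next
  case False
  then have "blocks p m (Suc i) (Suc k) = blocks p m (Suc i) k @ replicate (p k) Om1 @ replicate (m (k + 1)) Om0"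
    using assms by (intro blocks_Suc) auto
  then show ?thesis
    using assms set_blocks[of p m "Suc i" k] by (auto simp: admissible_def)
qed

lemma admissible_blocks_1:
  assumes "k \<ge> 1" "m (k + 1) \<ge> 1"
  shows "admissible (blocks p m 1 (Suc k))"
proof -
  have "blocks p m 1 (Suc k) = replicate (p 1) Om1 @ replicate (m (1 + 1)) Om0 @ blocks p m (Suc 1) (Suc k)"
    using assms by (intro blocks_rec) auto
  then show ?thesis
    using admissible_append_Om1[OF admissible_blocks[of 1 k m p, OF assms]] by simp
qed

text \<open>Induction on the number r of blocks already split, the last term keeping the tail of the
  rest. At r = k this tail is that of the empty word, 1.\<close>

lemma tail_sum_blocks:
  assumes "m (k + 1) \<ge> 1" "r \<le> k"
  shows "tail_sum (blocks p m 1 (Suc k)) n =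
    (\<Sum>i=1..r. (- 1) ^ (\<Sum>l=1..i - 1. p l) * (\<Sum>j<p i. (- 1) ^ j *
        tail_sum (replicate (p i - j) Om1 @ replicate (m (i + 1)) Om0 @ blocks p m (Suc i) (Suc k)) 0 *
        star_op (blocks p m 1 i @ replicate j Om1) (\<lambda>_. 1) n))
    + (- 1) ^ (\<Sum>l=1..r. p l) * star_op (blocks p m 1 (Suc r)) (tail_sum (blocks p m (Suc r) (Suc k))) n"
  using assms(2)
proof (induction r)
  case (Suc r)
  define V where "V = replicate (m (Suc r + 1)) Om0 @ blocks p m (Suc (Suc r)) (Suc k)"
  define q where "q = p (Suc r)"
  define W where "W = blocks p m 1 (Suc r)"
  have adm: "admissible V"
    unfolding V_def using Suc.prems assms by (intro admissible_blocks) auto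
  have "blocks p m (Suc r) (Suc k) = replicate q Om1 @ V"
    unfolding V_def q_def using Suc.prems by (subst blocks_rec) auto
  then have "tail_sum (blocks p m (Suc r) (Suc k)) = (\<lambda>n.
      (\<Sum>j<q. (- 1) ^ j * tail_sum (replicate (q - j) Om1 @ V) 0 * star_op (replicate j Om1) (\<lambda>_. 1) n)
      + (- 1) ^ q * star_op (replicate q Om1) (tail_sum V) n)"
    using tail_sum_Om1_power[OF adm, of q] by auto
  then have "star_op W (tail_sum (blocks p m (Suc r) (Suc k))) n =
      (\<Sum>j<q. (- 1) ^ j * tail_sum (replicate (q - j) Om1 @ V) 0 * star_op (W @ replicate j Om1) (\<lambda>_. 1) n)
      + (- 1) ^ q * star_op (W @ replicate q Om1) (tail_sum V) n"
    by (simp only: star_op_add star_op_sum star_op_mult star_op_append)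
  \<comment> \<open>Letters \<open>Om0\<close> act alike on tails and star sums, so those behind the
    block pass into the star word.\<close>
  also have "star_op (W @ replicate q Om1) (tail_sum V) = 
      star_op (blocks p m 1 (Suc (Suc r))) (tail_sum (blocks p m (Suc (Suc r)) (Suc k)))"
    by (subst blocks_Suc) (simp_all add: V_def q_def W_def tail_sum_Om0_power star_op_append)
  finally show ?case
    using Suc by (simp add: V_def q_def W_def power_add algebra_simps)
qed simp

section \<open>Both sides of the identity in terms of words\<close>

lemma index_word_E_index:
  assumes "i \<le> k" "\<And>l. l \<in> {1..k + 1} \<Longrightarrow> m l \<ge> 1"
  shows "index_word (E_index k p m i @ replicate j (Suc 0)) =
    rev (replicate (Suc j) Om1 @ replicate (m (i + 1)) Om0 @ blocks p m (Suc i) (Suc k))"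
proof -
  have *: "replicate (m (k + 1)) Om0 @ box_word (map (\<lambda>l. (p l, m l + 1)) (rev [i + 1..<k + 1]))
      = rev (replicate (m (i + 1)) Om0 @ blocks p m (Suc i) (Suc k))"
    using assms(1)
  proof (induction k rule: dec_induct)
    case base
    show ?case by simp
  next
    case (step k)
    then have "[i + 1..<Suc k + 1] = [i + 1..<k + 1] @ [k + 1]" by simp
    moreover have "blocks p m (Suc i) (Suc (Suc k))
        = blocks p m (Suc i) (Suc k) @ replicate (p (Suc k)) Om1 @ replicate (m (Suc k + 1)) Om0"
      using step by (intro blocks_Suc) auto
    ultimately show ?case
      using step.IH by (simp add: box_word_Cons)
  qed
  \<comment> \<open>The \<open>Om1\<close> closing a box string joins the j appended ones, hence
    \<open>Suc j\<close>.\<close>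
  have "replicate j Om1 @ [Om1] = Om1 # replicate j Om1"
    by (simp add: replicate_append_same)
  then show ?thesis
    unfolding E_index_def index_word_append index_word_ones
    by (subst index_word_box_string) (use * in auto)
qed

lemma E_index_pos:
  assumes "s \<in> set (E_index k p m i @ replicate j (Suc 0))"
  shows "s \<ge> 1"
  using assms box_string_pos[of "m (k + 1) + 1" "map (\<lambda>l. (p l, m l + 1)) (rev [i + 1..<k + 1])" s]
  by (auto simp: E_index_def simp del: upt_Suc split: if_splits)

text \<open>Identifies the full sums left behind by the splitting as zeta values.\<close>

lemma alt_mzv_E_index:
  assumes "i \<le> k" "\<And>l. l \<in> {1..k + 1} \<Longrightarrow> m l \<ge> 1"
  shows "alt_mzv (map int (E_index k p m i @ replicate j 1)) =
    tail_sum (replicate (Suc j) Om1 @ replicate (m (i + 1)) Om0 @ blocks p m (Suc i) (Suc k)) 0"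
proof -
  define ss where "ss = E_index k p m i @ replicate j (Suc 0)"
  define V where "V = replicate (Suc j) Om1 @ replicate (m (i + 1)) Om0 @ blocks p m (Suc i) (Suc k)"
  have adm: "admissible V"
    unfolding V_def using assms by (intro admissible_append_Om1 admissible_blocks) auto
  have coef: "word_coef (index_word ss) = fold int_form V unit_seq"
  proof -
    have "index_word ss = rev V"
      unfolding ss_def V_def by (rule index_word_E_index[OF assms])
    then show ?thesis by (simp add: word_coef_def foldr_conv_fold)
  qed
  have "alt_mzv (map int ss) = (\<Sum>n. word_coef (index_word ss) n)"
  proof (rule alt_mzv_eq_suminf)
    show "alt_mhs N (map int ss) = (\<Sum>l\<le>N. word_coef (index_word ss) l)" for N
      by (rule sum_word_coef_index[symmetric]) (use E_index_pos in \<open>auto simp: ss_def\<close>)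
    show "summable (word_coef (index_word ss))"
      unfolding coef by (rule tail_sum_pairing(1)[OF adm]) (auto simp: unit_seq_def sqrt_decay_unit_seq)
  qed
  also have "\<dots> = tail_sum V 0"
    unfolding coef tail_sum_at_0[OF adm] ..
  finally show ?thesis
    by (simp add: ss_def V_def)
qed

lemma lead_star_F_index:
  assumes "n \<ge> 1"
  shows "lead_star n (F_index p m i @ replicate j 1) = star_op (blocks p m 1 i @ replicate j Om1) (\<lambda>_. 1) n"
proof -
  have "box_word (map (\<lambda>l. (p l, m (l + 1) + 1)) [1..<i]) = blocks p m 1 i"
    by (simp add: box_word_def blocks_def o_def)
  then show ?thesis
    using lead_star_box_string[of 1 "map (\<lambda>l. (p l, m (l + 1) + 1)) [1..<i]" n j] assms
    by (simp add: F_index_def)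
qed

lemma word_coef_Om2_power_nonneg: "word_coef (replicate r Om2) n \<ge> 0"
  by (induction r arbitrary: n) (auto simp: unit_seq_def intro!: int_form_nonneg)

text \<open>The word of this index begins with \<open>OmN\<close> and ends with \<open>Om1\<close>,
  so duality applies; its block of dt/(1+t) accounts for both overlines and the sign.\<close>

lemma alt_mzv_lhs_index:
  assumes "k \<ge> 1" and m: "\<And>l. l \<in> {1..k + 1} \<Longrightarrow> m l \<ge> 1"
  shows "(- 1) ^ m 1 * alt_mzv (lhs_index k p m) =
    (\<Sum>n. fold int_form (blocks p m 1 (Suc k)) (word_coef (replicate (m 1) Om2)) n)"
proof -
  \<comment> \<open>\<open>ss\<close> carries no overlines: the one on p_1 + 1 is produced by the
    \<open>OmN\<close> block in front.\<close>
  define ss where "ss = concat (map (\<lambda>l. (p l + 1) # replicate (m (l + 1) - 1) 1) [1..<k + 1])"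
  define ts where "ts = replicate (m 2 - 1) 1 @ concat (map (\<lambda>l. (p l + 1) # replicate (m (l + 1) - 1) 1) [2..<k + 1])"
  define w where "w = replicate (m 1) OmN @ index_word ss"
  have "[1..<k + 1] = 1 # [2..<k + 1]"
    using assms(1) upt_conv_Cons[of 1 "k + 1"] by (simp add: numeral_2_eq_2 del: upt_Suc)
  then have ss: "ss = (p 1 + 1) # ts"
    by (simp add: ss_def ts_def numeral_2_eq_2 del: upt_Suc)
  obtain q where q: "m 1 = Suc q" using m[of 1] by (cases "m 1") auto
  have lhs: "lhs_index k p m = - 1 # replicate q 1 @ - int (p 1 + 1) # map int ts"
    by (simp add: lhs_index_def ts_def q[simplified] map_concat o_def del: upt_Suc)
  have ts: "\<forall>s\<in>set ts. s \<ge> 1"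
    by (auto simp: ts_def simp del: upt_Suc split: if_splits)
  have index_ss: "index_word ss = concat (map (\<lambda>l. replicate (p l) Om0 @ replicate (m (l + 1)) Om1) [1..<k + 1])"
  proof -
    have "index_word (concat (map (\<lambda>l. (p l + 1) # replicate (m (l + 1) - 1) 1) ls))
        = concat (map (\<lambda>l. replicate (p l) Om0 @ replicate (m (l + 1)) Om1) ls)"
      if "\<forall>l\<in>set ls. l \<in> {1..k}" for ls
      using that
    proof (induction ls)
      case (Cons l ls)
      then obtain r where "m (l + 1) = Suc r"
        using m[of "l + 1"] by (cases "m (l + 1)") auto
      then show ?case
        using Cons by (simp add: index_word_Cons index_word_append index_word_ones)
    qed simp
    then show ?thesis by (simp add: ss_def del: upt_Suc)
  qed
  have dual: "map dual_form w = replicate (m 1) Om2 @ blocks p m 1 (Suc k)"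
    unfolding w_def index_ss blocks_def by (simp add: map_concat o_def del: upt_Suc)
  have coef_dual: "word_coef (dual_word w) = fold int_form (blocks p m 1 (Suc k)) (word_coef (replicate (m 1) Om2))"
    by (simp add: word_coef_def foldr_conv_fold dual_word_def rev_map dual)
  have adm: "admissible (blocks p m 1 (Suc k))"
    using assms by (intro admissible_blocks_1) auto
  have sm': "summable (word_coef (dual_word w))"
    unfolding coef_dual by (intro tail_sum_pairing(1) adm sqrt_decay_word_coef word_coef_Om2_power_nonneg)
  have sm: "summable (word_coef w)"
    unfolding w_def q by (simp add: summable_int_form_OmN sqrt_decay_word_coef)
  have "w \<noteq> []" unfolding w_def q by simp
  \<comment> \<open>The last letter is read off the dual word, whose outermost form is dt/t by
    admissibility.\<close>
  then have "dual_form (last w) = last (map dual_form w)"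
    by (simp add: last_map)
  also have "\<dots> = Om0"
    using adm by (simp add: dual admissible_def)
  finally have "last w = Om1"
    by (cases "last w") auto
  then have "(\<Sum>n. word_coef w n) = (\<Sum>n. word_coef (dual_word w) n)"
    by (intro word_coef_duality sm sm') (auto simp: w_def q[simplified])
  moreover have "alt_mzv (lhs_index k p m) = (\<Sum>n. (- 1) ^ m 1 * word_coef w n)"
  proof (rule alt_mzv_eq_suminf)
    show "alt_mhs N (lhs_index k p m) = (\<Sum>l\<le>N. (- 1) ^ m 1 * word_coef w l)" for N
    proof -
      have "(\<Sum>l\<le>N. word_coef w l) = (- 1) ^ m 1 * alt_mhs N (lhs_index k p m)"
        unfolding w_def lhs ss q by (rule sum_word_coef_OmN_power) (use ts in auto)
      then show ?thesis
        by (simp add: sum_distrib_left[symmetric] mult.assoc[symmetric] power_mult_distrib[symmetric])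
    qed
    show "summable (\<lambda>n. (- 1) ^ m 1 * word_coef w n)"
      by (intro summable_mult sm)
  qed
  then have "(- 1) ^ m 1 * alt_mzv (lhs_index k p m) = (\<Sum>n. word_coef w n)"
    by (simp add: suminf_mult[OF sm] mult.assoc[symmetric] power_mult_distrib[symmetric])
  ultimately show ?thesis
    by (simp add: coef_dual)
qed

text \<open>Weights of size 2^(-n) against growth (3/2)^n leave the ratio 3/4.\<close>

lemma summable_Om2_power_star_op:
  "summable (\<lambda>n. word_coef (replicate q Om2) n * star_op V (\<lambda>_. 1) n)"
proof (rule summable_comparison_test)
  have "norm (word_coef (replicate q Om2) n * star_op V (\<lambda>_. 1) n) \<le> 3 ^ length V * (3 / 4) ^ n" for n
  proof -
    have "\<bar>word_coef (replicate q Om2) n\<bar> \<le> 1 / 2 ^ n"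
      using word_coef_le_1[of "replicate q Om1" n] by (simp add: word_coef_Om2_power divide_right_mono)
    then have "\<bar>word_coef (replicate q Om2) n\<bar> * \<bar>star_op V (\<lambda>_. 1) n\<bar> \<le> 1 / 2 ^ n * (3 ^ length V * (3 / 2) ^ n)"
      by (intro mult_mono star_op_geometric_bound) auto
    also have "\<dots> = 3 ^ length V * ((1 / 2) ^ n * (3 / 2) ^ n)"
      by (simp add: power_one_over)
    also have "(1 / 2 :: real) ^ n * (3 / 2) ^ n = (3 / 4) ^ n"
      by (simp flip: power_mult_distrib)
    finally show ?thesis by (simp add: abs_mult)
  qed
  then show "\<exists>N. \<forall>n\<ge>N. norm (word_coef (replicate q Om2) n * star_op V (\<lambda>_. 1) n) \<le> 3 ^ length V * (3 / 4) ^ n"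
    by blast
  show "summable (\<lambda>n. 3 ^ length V * (3 / 4 :: real) ^ n)"
    by (intro summable_mult summable_geometric) auto
qed

text \<open>The term n = 0 vanishes because q >= 1, so \<open>F\<close> is compared only for n >= 1,
  the range covered by \<open>lead_star_F_index\<close>.\<close>

lemma suminf_Om2_power_star_op:
  assumes "q \<ge> 1" and F: "\<And>n. n \<ge> 1 \<Longrightarrow> F n = star_op V (\<lambda>_. 1) n"
  shows "(\<Sum>n. word_coef (replicate q Om2) n * star_op V (\<lambda>_. 1) n) =
    (\<Sum>n. mhs n (replicate (q - 1) 1) * F (Suc n) / (real (Suc n) * 2 ^ Suc n))"
proof -
  obtain r where q: "q = Suc r" using assms by (cases q) auto
  have "(\<Sum>n. word_coef (replicate q Om2) n * star_op V (\<lambda>_. 1) n) =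
      (\<Sum>n. word_coef (replicate q Om2) (Suc n) * star_op V (\<lambda>_. 1) (Suc n))"
    using suminf_split_head[OF summable_Om2_power_star_op[of q V]] by (simp add: q)
  also have "(\<lambda>n. word_coef (replicate q Om2) (Suc n) * star_op V (\<lambda>_. 1) (Suc n)) =
      (\<lambda>n. mhs n (replicate (q - 1) 1) * F (Suc n) / (real (Suc n) * 2 ^ Suc n))"
    unfolding word_coef_Om2_power q word_coef_Om1_power F[OF Suc_le_mono[THEN iffD2, OF le0, folded One_nat_def]]
    by simp
  finally show ?thesis .
qed

theorem theorem3p4:
  fixes k :: nat and p m :: "nat \<Rightarrow> nat"
  assumes "k \<ge> 1"
    and "\<And>l. l \<in> {1..k + 1} \<Longrightarrow> m l \<ge> 1"
  shows "(- 1) ^ m 1 * alt_mzv (lhs_index k p m) =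
    (\<Sum>i = 1..k. (- 1) ^ (\<Sum>l = 1..i - 1. p l) *
       (\<Sum>j = 1..p i. (- 1) ^ (j - 1) *
          alt_mzv (map int (E_index k p m i @ replicate (p i - j) 1)) *
          (\<Sum>n. mhs n (replicate (m 1 - 1) 1) *
                 lead_star (Suc n) (F_index p m i @ replicate (j - 1) 1) /
                 (real (Suc n) * 2 ^ Suc n))))
    + (- 1) ^ (\<Sum>l = 1..k. p l) *
       (\<Sum>n. mhs n (replicate (m 1 - 1) 1) * lead_star (Suc n) (F_index p m (k + 1)) /
              (real (Suc n) * 2 ^ Suc n))"
proof -
  define g where "g = word_coef (replicate (m 1) Om2)"
  define sgm where "sgm i = (- 1 :: real) ^ (\<Sum>l = 1..i. p l)" for i
  define Z where "Z i j = tail_sum (replicate (p i - j) Om1 @ replicate (m (i + 1)) Om0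
      @ blocks p m (Suc i) (Suc k)) 0" for i j
  define X where "X i j = blocks p m 1 i @ replicate j Om1" for i j
  define G where "G V = (\<Sum>n. g n * star_op V (\<lambda>_. 1) n)" for V
  have m1: "m 1 \<ge> 1" using assms(2) by simp
  have adm: "admissible (blocks p m 1 (Suc k))"
    using assms by (intro admissible_blocks_1) auto
  have g0: "g n \<ge> 0" for n
    unfolding g_def by (rule word_coef_Om2_power_nonneg)
  have G: "(\<lambda>n. g n * star_op V (\<lambda>_. 1) n) sums G V" for V
    unfolding G_def g_def by (intro summable_sums summable_Om2_power_star_op)
  \<comment> \<open>Duality, then pairing: the block of dt/(2-t) gives the weights \<open>g\<close>,
    and the remaining word acts on monomials.\<close>
  have "(- 1) ^ m 1 * alt_mzv (lhs_index k p m) = (\<Sum>n. g n * tail_sum (blocks p m 1 (Suc k)) n)"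
    using alt_mzv_lhs_index[of k m p, OF assms] tail_sum_pairing(2)[OF adm g0]
    by (simp add: g_def sqrt_decay_word_coef)
  also have "(\<lambda>n. g n * tail_sum (blocks p m 1 (Suc k)) n) =
      (\<lambda>n. (\<Sum>i=1..k. sgm (i - 1) * (\<Sum>j<p i. (- 1) ^ j * Z i j * (g n * star_op (X i j) (\<lambda>_. 1) n)))
         + sgm k * (g n * star_op (X (Suc k) 0) (\<lambda>_. 1) n))"
  proof
    fix n
    have one: "tail_sum [] = (\<lambda>_. 1)" by auto
    have "tail_sum (blocks p m 1 (Suc k)) n =
        (\<Sum>i=1..k. sgm (i - 1) * (\<Sum>j<p i. (- 1) ^ j * Z i j * star_op (X i j) (\<lambda>_. 1) n))
         + sgm k * star_op (X (Suc k) 0) (\<lambda>_. 1) n"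
      using tail_sum_blocks[of m k k p n] assms(2)[of "k + 1"]
      by (simp add: sgm_def Z_def X_def one)
    then show "g n * tail_sum (blocks p m 1 (Suc k)) n =
      (\<Sum>i=1..k. sgm (i - 1) * (\<Sum>j<p i. (- 1) ^ j * Z i j * (g n * star_op (X i j) (\<lambda>_. 1) n)))
         + sgm k * (g n * star_op (X (Suc k) 0) (\<lambda>_. 1) n)"
      by (simp add: distrib_left sum_distrib_left mult_ac)
  qed
  \<comment> \<open>For each n the expression is a finite linear combination of terms of convergent
    series, so the sum over n moves inside.\<close>
  also have "suminf \<dots> = (\<Sum>i=1..k. sgm (i - 1) * (\<Sum>j<p i. (- 1) ^ j * Z i j * G (X i j)))
      + sgm k * G (X (Suc k) 0)"
    by (intro sums_unique[symmetric] sums_add sums_sum sums_mult G)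
  also have "\<dots> = (\<Sum>i=1..k. sgm (i - 1) * (\<Sum>j=1..p i. (- 1) ^ (j - 1) * Z i (j - 1) * G (X i (j - 1))))
      + sgm k * G (X (Suc k) 0)"
  proof -
    have "(\<Sum>j<p i. (- 1) ^ j * Z i j * G (X i j))
        = (\<Sum>j=1..p i. (- 1) ^ (j - 1) * Z i (j - 1) * G (X i (j - 1)))" for i
      by (rule sum.reindex_bij_witness[of _ "\<lambda>j. j - 1" Suc]) auto
    then show ?thesis by simp
  qed
  also have "(\<Sum>i=1..k. sgm (i - 1) * (\<Sum>j=1..p i. (- 1) ^ (j - 1) * Z i (j - 1) * G (X i (j - 1)))) =
    (\<Sum>i = 1..k. (- 1) ^ (\<Sum>l = 1..i - 1. p l) *
       (\<Sum>j = 1..p i. (- 1) ^ (j - 1) *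
          alt_mzv (map int (E_index k p m i @ replicate (p i - j) 1)) *
          (\<Sum>n. mhs n (replicate (m 1 - 1) 1) *
                 lead_star (Suc n) (F_index p m i @ replicate (j - 1) 1) /
                 (real (Suc n) * 2 ^ Suc n))))"
  proof (intro sum.cong refl arg_cong2[where f = "(*)"])
    fix i j assume i: "i \<in> {1..k}" and j: "j \<in> {1..p i}"
    \<comment> \<open>With j counted from 1 there are p_i - j + 1 letters \<open>Om1\<close>, one of
      which belongs to the last entry of E.\<close>
    have "p i - (j - 1) = Suc (p i - j)" using j by auto
    then show "Z i (j - 1) = alt_mzv (map int (E_index k p m i @ replicate (p i - j) 1))"
      using i alt_mzv_E_index[of i k m p "p i - j", OF _ assms(2)] by (simp add: Z_def)
    show "G (X i (j - 1)) = (\<Sum>n. mhs n (replicate (m 1 - 1) 1) *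
        lead_star (Suc n) (F_index p m i @ replicate (j - 1) 1) / (real (Suc n) * 2 ^ Suc n))"
      unfolding G_def g_def X_def by (intro suminf_Om2_power_star_op[OF m1] lead_star_F_index)
  qed (simp_all add: sgm_def)
  also have "G (X (Suc k) 0) = (\<Sum>n. mhs n (replicate (m 1 - 1) 1) * lead_star (Suc n) (F_index p m (k + 1)) /
              (real (Suc n) * 2 ^ Suc n))"
    unfolding G_def g_def X_def using lead_star_F_index[of _ p m "k + 1" 0]
    by (intro suminf_Om2_power_star_op[OF m1]) simp
  finally show ?thesis
    by (simp only: sgm_def)
qed

end
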